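(* Let $f$ satisfy Assumption (M) with exponent $p>1$. Then there exist $C^+=C^+(f,N)>0$ and $\varepsilon_0>0$ such that for every $\varepsilon\in(0,\varepsilon_0)$ there is $L_\varepsilon>0$, with $L_\varepsilon\sim C^+\varepsilon^{-\frac{p-1}{2}}\left(\ln\frac1\varepsilon\right)^{1/2}$ as $\varepsilon\to0$, such that for every $L>L_\varepsilon$ the solution $u$ of $u_t=\Delta u+f(u)$ on $(0,\infty)\times\mathbb R^N$ with $u(0,x)=\varepsilon\mathbf 1_{B_L}(x)$ satisfies $u(t,x)\to1$ as $t\to+\infty$, locally uniformly in $x\in\mathbb R^N$.
   Context: Assumption (M): $f:\mathbb R\to\mathbb R$ is locally Lipschitz continuous, $f=0$ on $(-\infty,0]\cup[1,\infty)$, $f(u)>0$ for all $u\in(0,1)$, and for some $p>1$, $0<\liminf_{u\to0^+}f(u)/u^p\le\limsup_{u\to0^+}f(u)/u^p<+\infty$. $B_L$ is the open ball of radius $L$ centred at $0$ in $\mathbb R^N$. *)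

theory Defs
  imports "HOL-Analysis.Analysis" "HOL-Library.Landau_Symbols" "HOL-Library.Liminf_Limsup"
begin

definition assumption_M :: "(real \<Rightarrow> real) \<Rightarrow> real \<Rightarrow> bool" where
  "assumption_M f p \<longleftrightarrow>
     p > 1 \<and>
     (\<forall>x. \<exists>d>0. \<exists>C. C-lipschitz_on (ball x d) f) \<and>
     (\<forall>u. u \<le> 0 \<longrightarrow> f u = 0) \<and> (\<forall>u. u \<ge> 1 \<longrightarrow> f u = 0) \<and>
     (\<forall>u. 0 < u \<and> u < 1 \<longrightarrow> f u > 0) \<and>
     0 < Liminf (at_right 0) (\<lambda>u. ereal (f u / u powr p)) \<and>
     Limsup (at_right 0) (\<lambda>u. ereal (f u / u powr p)) < \<infinity>"

definition partial :: "'a::euclidean_space \<Rightarrow> ('a \<Rightarrow> real) \<Rightarrow> 'a \<Rightarrow> real" where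
  "partial b g x = deriv (\<lambda>h. g (x + h *\<^sub>R b)) 0"

definition laplacian :: "('a::euclidean_space \<Rightarrow> real) \<Rightarrow> 'a \<Rightarrow> real" where
  "laplacian g x = (\<Sum>b\<in>Basis. partial b (partial b g) x)"

text \<open>u is a bounded classical (C^{1,2}) solution of u_t = \<Delta>u + f(u) on (0,\<infinity>) \<times> R^N,
  taking the (possibly discontinuous) initial datum u0 in the L^1_loc sense.\<close>
definition heat_solution ::
  "(real \<Rightarrow> real) \<Rightarrow> ('a::euclidean_space \<Rightarrow> real) \<Rightarrow> (real \<Rightarrow> 'a \<Rightarrow> real) \<Rightarrow> bool" where
  "heat_solution f u0 u \<longleftrightarrow>
     (\<exists>M. \<forall>t>0. \<forall>x. \<bar>u t x\<bar> \<le> M) \<and>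
     continuous_on ({0<..} \<times> UNIV) (\<lambda>(t,x). u t x) \<and>
     (\<forall>t>0. \<forall>x. \<forall>b\<in>Basis.
        (\<lambda>h. u t (x + h *\<^sub>R b)) differentiable (at 0) \<and>
        (\<lambda>h. partial b (u t) (x + h *\<^sub>R b)) differentiable (at 0)) \<and>
     (\<forall>b\<in>Basis. continuous_on ({0<..} \<times> UNIV) (\<lambda>(t,x). partial b (u t) x) \<and>
        continuous_on ({0<..} \<times> UNIV) (\<lambda>(t,x). partial b (partial b (u t)) x)) \<and>
     (\<forall>t>0. \<forall>x. ((\<lambda>s. u s x) has_real_derivative (laplacian (u t) x + f (u t x))) (at t)) \<and>
     (\<forall>K. compact K \<longrightarrow>
        ((\<lambda>t. integral K (\<lambda>x. \<bar>u t x - u0 x\<bar>)) \<longlongrightarrow> 0) (at_right 0))"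

end

theory Submission
  imports Defs
begin

text \<open>
  All barriers are polynomials. If \<open>q = 1 - |x - \<xi>|\<^sup>2 / \<rho>\<^sup>2\<close>, then
  \<open>\<Delta>(q\<^sup>2) = (8 - (4N + 8) q) / \<rho>\<^sup>2\<close> is positive near the boundary of the ball
  \<open>q > 0\<close>, while away from it \<open>f (a q\<^sup>2) \<ge> c (a q\<^sup>2)\<^sup>p\<close> dominates as soon as
  \<open>\<rho>\<^sup>2\<close> is a large multiple of \<open>a\<^bsup>-(p - 1)\<^esup>\<close>. So \<open>a q\<^sup>2\<close> is a strict
  stationary subsolution, with room left both for \<open>a\<close> to grow and for the centre \<open>\<xi>\<close> to move
  at a small constant speed. Starting from \<open>a = \<epsilon> / 2\<close> and \<open>\<rho> = L / 2\<close> the amplitude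
  first grows to \<open>1 / 2\<close>; moving the bump then gives \<open>u \<ge> 1 / 2\<close> on every ball at all late
  times; finally bumps of a larger radius grow from \<open>1 / 2\<close> to \<open>1 - \<eta>\<close>.
  The logarithm in \<open>L\<^sub>\<epsilon>\<close> is more than what this needs, so \<open>C\<^sup>+ = 1\<close> works.

  The initial datum is only attained in \<open>L\<^sup>1\<^sub>l\<^sub>o\<^sub>c\<close>. Averaging over a small cube commutes with
  the heat operator and turns this into locally uniform convergence, so that
  the classical minimum principle applies to the averages.
\<close>

subsection \<open>Minimum principle\<close>

text \<open>A pointwise relation with the derivatives as witnesses: only the germ of
  \<open>g\<close> along the coordinate lines through \<open>x\<close> matters, so it applies to a
  truncated barrier that is not twice differentiable elsewhere.\<close>

definition has_laplacian :: "('a::euclidean_space \<Rightarrow> real) \<Rightarrow> 'a \<Rightarrow> real \<Rightarrow> bool" where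
  "has_laplacian g x l \<longleftrightarrow> (\<exists>\<phi> D. l = (\<Sum>b\<in>Basis. D b) \<and>
     (\<forall>b\<in>Basis.
        (\<forall>\<^sub>F h in nhds 0. ((\<lambda>h. g (x + h *\<^sub>R b)) has_real_derivative \<phi> b h) (at h)) \<and>
        (\<phi> b has_real_derivative D b) (at 0)))"

text \<open>If \<open>D < 0\<close>, then \<open>\<phi>'\<close>, which vanishes at the minimum, is
  negative just to the right of 0, and the mean value theorem pushes \<open>\<phi>\<close> below
  \<open>\<phi> 0\<close>.\<close>

lemma second_derivative_nonneg_at_local_min:
  fixes \<phi> \<phi>' :: "real \<Rightarrow> real"
  assumes d1: "\<forall>\<^sub>F h in nhds 0. (\<phi> has_real_derivative \<phi>' h) (at h)"
    and d2: "(\<phi>' has_real_derivative D) (at 0)"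
    and mn: "\<forall>\<^sub>F h in nhds 0. \<phi> 0 \<le> \<phi> h"
  shows "0 \<le> D"
proof (rule ccontr)
  assume "\<not> 0 \<le> D"
  then have "D < 0" by simp
  from d1 obtain e1 where e1: "e1 > 0" "\<And>h. \<bar>h\<bar> < e1 \<Longrightarrow> (\<phi> has_real_derivative \<phi>' h) (at h)"
    unfolding eventually_nhds_metric by (auto simp: dist_real_def)
  from mn obtain e2 where e2: "e2 > 0" "\<And>h. \<bar>h\<bar> < e2 \<Longrightarrow> \<phi> 0 \<le> \<phi> h"
    unfolding eventually_nhds_metric by (auto simp: dist_real_def)
  have z: "\<phi>' 0 = 0"
    by (rule DERIV_local_min[OF e1(2) e2(1)]) (use e1 e2 in auto)
  obtain e3 where e3: "e3 > 0" "\<And>h. 0 < h \<Longrightarrow> h < e3 \<Longrightarrow> \<phi>' h < 0"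
    using DERIV_neg_dec_right[OF d2 \<open>D < 0\<close>] z by auto
  define h where "h = min e1 (min e2 e3) / 2"
  have h: "0 < h" "h < e1" "h < e2" "h < e3" using e1 e2 e3 by (auto simp: h_def)
  obtain y where y: "0 < y" "y < h" "\<phi> h - \<phi> 0 = (h - 0) * \<phi>' y"
    using MVT2[OF h(1), of \<phi> \<phi>'] e1(2) h by force
  have "\<phi>' y < 0" using e3(2) y h by auto
  then have "\<phi> h - \<phi> 0 < 0" using y h by (simp add: mult_pos_neg)
  then show False using e2(2)[of h] h by simp
qed

lemma has_laplacian_nonneg_at_local_min:
  fixes g :: "'a::euclidean_space \<Rightarrow> real"
  assumes "has_laplacian g x l" and mn: "\<forall>\<^sub>F y in nhds x. g x \<le> g y"
  shows "0 \<le> l"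
proof -
  from assms(1) obtain \<phi> D where l: "l = (\<Sum>b\<in>Basis. D b)"
    and D: "\<And>b. b \<in> Basis \<Longrightarrow>
        (\<forall>\<^sub>F h in nhds 0. ((\<lambda>h. g (x + h *\<^sub>R b)) has_real_derivative \<phi> b h) (at h))"
      "\<And>b. b \<in> Basis \<Longrightarrow> (\<phi> b has_real_derivative D b) (at 0)"
    unfolding has_laplacian_def by blast
  have "0 \<le> D b" if b: "b \<in> Basis" for b
  proof (rule second_derivative_nonneg_at_local_min[OF D(1)[OF b] D(2)[OF b]])
    have "((\<lambda>h. x + h *\<^sub>R b) \<longlongrightarrow> x + 0 *\<^sub>R b) (nhds (0::real))"
      by (intro tendsto_intros filterlim_ident)
    then have "filterlim (\<lambda>h. x + h *\<^sub>R b) (nhds x) (nhds (0::real))" by simp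
    from eventually_compose_filterlim[OF mn this]
    show "\<forall>\<^sub>F h in nhds 0. g (x + 0 *\<^sub>R b) \<le> g (x + h *\<^sub>R b)" by simp
  qed
  then show ?thesis by (simp add: l sum_nonneg)
qed

lemma has_laplacian_add:
  assumes "has_laplacian g x l" "has_laplacian k x m"
  shows "has_laplacian (\<lambda>y. g y + k y) x (l + m)"
proof -
  from assms(1) obtain \<phi> D where 1: "l = (\<Sum>b\<in>Basis. D b)" "\<forall>b\<in>Basis.
        (\<forall>\<^sub>F h in nhds 0. ((\<lambda>h. g (x + h *\<^sub>R b)) has_real_derivative \<phi> b h) (at h)) \<and>
        (\<phi> b has_real_derivative D b) (at 0)"
    unfolding has_laplacian_def by blast
  from assms(2) obtain \<psi> E where 2: "m = (\<Sum>b\<in>Basis. E b)" "\<forall>b\<in>Basis.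
        (\<forall>\<^sub>F h in nhds 0. ((\<lambda>h. k (x + h *\<^sub>R b)) has_real_derivative \<psi> b h) (at h)) \<and>
        (\<psi> b has_real_derivative E b) (at 0)"
    unfolding has_laplacian_def by blast
  show ?thesis
    unfolding has_laplacian_def
  proof (intro exI conjI ballI)
    show "l + m = (\<Sum>b\<in>Basis. D b + E b)" by (simp add: 1 2 sum.distrib)
    fix b :: 'a assume b: "b \<in> Basis"
    show "\<forall>\<^sub>F h in nhds 0. ((\<lambda>h. g (x + h *\<^sub>R b) + k (x + h *\<^sub>R b))
            has_real_derivative (\<lambda>h. \<phi> b h + \<psi> b h) h) (at h)"
      using 1(2)[rule_format, OF b, THEN conjunct1] 2(2)[rule_format, OF b, THEN conjunct1]
      by eventually_elim (auto intro!: derivative_intros)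
    show "((\<lambda>h. \<phi> b h + \<psi> b h) has_real_derivative D b + E b) (at 0)"
      using 1(2) 2(2) b by (auto intro!: derivative_intros)
  qed
qed

text \<open>Lets a smooth polynomial stand in for its truncation near a point where the truncation
  is inactive.\<close>

lemma has_laplacian_cong:
  fixes x :: "'a::euclidean_space"
  assumes "has_laplacian g x l" "\<forall>\<^sub>F y in nhds x. g y = k y"
  shows "has_laplacian k x l"
proof -
  from assms(1) obtain \<phi> D where l: "l = (\<Sum>b\<in>Basis. D b)"
    and D: "\<And>b. b \<in> Basis \<Longrightarrow>
        (\<forall>\<^sub>F h in nhds 0. ((\<lambda>h. g (x + h *\<^sub>R b)) has_real_derivative \<phi> b h) (at h))"
      "\<And>b. b \<in> Basis \<Longrightarrow> (\<phi> b has_real_derivative D b) (at 0)"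
    unfolding has_laplacian_def by blast
  have "\<forall>\<^sub>F h in nhds 0. ((\<lambda>h. k (x + h *\<^sub>R b)) has_real_derivative \<phi> b h) (at h)"
    if b: "b \<in> Basis" for b
  proof -
    have "((\<lambda>h. x + h *\<^sub>R b) \<longlongrightarrow> x + 0 *\<^sub>R b) (nhds (0::real))"
      by (intro tendsto_intros filterlim_ident)
    then have "filterlim (\<lambda>h. x + h *\<^sub>R b) (nhds x) (nhds (0::real))" by simp
    from eventually_compose_filterlim[OF assms(2) this]
    \<comment> \<open>The derivative at a small \<open>h\<close> requires equality for all
      parameters near \<open>h\<close>, not only at \<open>h\<close> itself.\<close>
    have "\<forall>\<^sub>F h in nhds 0. \<forall>\<^sub>F h in nhds h. g (x + h *\<^sub>R b) = k (x + h *\<^sub>R b)"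
      by (simp add: eventually_eventually)
    with D(1)[OF b] show ?thesis
    proof eventually_elim
      case (elim h)
      show ?case using elim(1) DERIV_cong_ev[OF refl elim(2) refl] by simp
    qed
  qed
  with l D(2) show ?thesis unfolding has_laplacian_def by blast
qed

text \<open>At a negative minimum of \<open>exp (- K * t) * d t x\<close> the Laplacian is
  nonnegative and the weighted function does not increase in time, so
  \<open>dt - l \<le> K * d t x\<close>. Asking for the differential inequality only where
  \<open>d t x < 0\<close> lets \<open>d\<close> be nonsmooth elsewhere.\<close>

lemma parabolic_minimum_principle:
  fixes d :: "real \<Rightarrow> 'a::euclidean_space \<Rightarrow> real"
  assumes cont: "continuous_on ({T..T'} \<times> cball z R) (\<lambda>(t,x). d t x)"
    and init: "\<And>x. x \<in> cball z R \<Longrightarrow> 0 \<le> d T x"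
    and bdry: "\<And>t x. T \<le> t \<Longrightarrow> t \<le> T' \<Longrightarrow> dist z x = R \<Longrightarrow> 0 \<le> d t x"
    and int: "\<And>t x. T < t \<Longrightarrow> t \<le> T' \<Longrightarrow> dist z x < R \<Longrightarrow> d t x < 0 \<Longrightarrow>
       \<exists>dt l. ((\<lambda>s. d s x) has_real_derivative dt) (at t) \<and> has_laplacian (d t) x l \<and> dt - l > K * d t x"
    and tx: "T \<le> t" "t \<le> T'" "x \<in> cball z R"
  shows "0 \<le> d t x"
proof (rule ccontr)
  assume neg: "\<not> 0 \<le> d t x"
  let ?S = "{T..T'} \<times> cball z R"
  have "compact ?S" by (intro compact_Times) auto
  moreover have "?S \<noteq> {}" using tx by (metis atLeastAtMost_iff SigmaI empty_iff)
  moreover have "continuous_on ?S (\<lambda>p. exp (- K * fst p) * (\<lambda>(t,x). d t x) p)"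
    by (intro continuous_intros cont)
  ultimately have "\<exists>q\<in>?S. \<forall>p\<in>?S.
      exp (- K * fst q) * (\<lambda>(t,x). d t x) q \<le> exp (- K * fst p) * (\<lambda>(t,x). d t x) p"
    by (rule continuous_attains_inf)
  then obtain q where q: "q \<in> ?S"
    "\<forall>p\<in>?S. exp (- K * fst q) * (\<lambda>(t,x). d t x) q \<le> exp (- K * fst p) * (\<lambda>(t,x). d t x) p" ..
  obtain s y where sy: "q = (s, y)" by (cases q)
  have s: "T \<le> s" "s \<le> T'" "y \<in> cball z R" using q(1) sy by auto
  have mn: "exp (- K * s) * d s y \<le> exp (- K * r) * d r w"
    if "T \<le> r" "r \<le> T'" "w \<in> cball z R" for r w
    using q(2) sy that by force
  have "exp (- K * s) * d s y \<le> exp (- K * t) * d t x" using mn tx by blast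
  also have "\<dots> < 0" using neg by (simp add: mult_pos_neg)
  finally have dneg: "d s y < 0" by (simp add: mult_less_0_iff)
  have s1: "T < s" using init[OF s(3)] dneg s(1) by (cases "T = s") auto
  have s2: "dist z y < R" using bdry[OF s(1,2), of y] dneg s(3) by fastforce
  obtain dt l where dt: "((\<lambda>s. d s y) has_real_derivative dt) (at s)"
    and l: "has_laplacian (d s) y l" and gt: "dt - l > K * d s y"
    using int[OF s1 s(2) s2 dneg] by blast
  have "0 \<le> l"
  proof (rule has_laplacian_nonneg_at_local_min[OF l])
    have "\<forall>\<^sub>F w in nhds y. w \<in> ball z R" using s2 by (intro eventually_nhds_in_open) auto
    then show "\<forall>\<^sub>F w in nhds y. d s y \<le> d s w"
    proof eventually_elim
      case (elim w)
      then show ?case using mn[of s w] s by auto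
    qed
  qed
  \<comment> \<open>Only earlier times are compared, so the case \<open>s = T'\<close> is
    covered.\<close>
  moreover have "dt - K * d s y \<le> 0"
  proof (rule ccontr)
    assume "\<not> dt - K * d s y \<le> 0"
    then have "exp (- K * s) * (dt - K * d s y) > 0" by simp
    moreover have "((\<lambda>r. exp (- K * r) * d r y) has_real_derivative exp (- K * s) * (dt - K * d s y)) (at s)"
      by (rule derivative_eq_intros dt refl)+ (simp add: algebra_simps)
    ultimately obtain e where e: "e > 0" "\<And>h. 0 < h \<Longrightarrow> h < e \<Longrightarrow>
        exp (- K * (s - h)) * d (s - h) y < exp (- K * s) * d s y"
      using DERIV_pos_inc_left by blast
    define h where "h = min (e / 2) (s - T)"
    have h: "0 < h" "h < e" "h \<le> s - T" using e s1 by (auto simp: h_def)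
    show False using e(2)[OF h(1,2)] mn[of "s - h" y] h s by auto
  qed
  ultimately show False using gt by linarith
qed

subsection \<open>Functions of class \<open>C\<^bsup>1,2\<^esup>\<close> and their cube averages\<close>

text \<open>The derivatives are carried as explicit functions, so that sums and box integrals
  transform them by formulas. Nothing is asked at \<open>t = 0\<close>, where the datum may be
  discontinuous.\<close>

definition C12 :: "(real \<Rightarrow> 'a::euclidean_space \<Rightarrow> real) \<Rightarrow> (real \<Rightarrow> 'a \<Rightarrow> real) \<Rightarrow>
    ('a \<Rightarrow> real \<Rightarrow> 'a \<Rightarrow> real) \<Rightarrow> ('a \<Rightarrow> real \<Rightarrow> 'a \<Rightarrow> real) \<Rightarrow> bool" where
  "C12 w wt wb wbb \<longleftrightarrow>
     continuous_on ({0<..} \<times> UNIV) (\<lambda>(t,x). w t x) \<and>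
     continuous_on ({0<..} \<times> UNIV) (\<lambda>(t,x). wt t x) \<and>
     (\<forall>b\<in>Basis. continuous_on ({0<..} \<times> UNIV) (\<lambda>(t,x). wb b t x) \<and>
        continuous_on ({0<..} \<times> UNIV) (\<lambda>(t,x). wbb b t x)) \<and>
     (\<forall>t>0. \<forall>x. ((\<lambda>s. w s x) has_real_derivative wt t x) (at t) \<and>
        (\<forall>b\<in>Basis. ((\<lambda>h. w t (x + h *\<^sub>R b)) has_real_derivative wb b t x) (at 0) \<and>
           ((\<lambda>h. wb b t (x + h *\<^sub>R b)) has_real_derivative wbb b t x) (at 0)))"

lemma has_real_derivative_along_line:
  fixes g :: "'a::real_vector \<Rightarrow> real"
  assumes "\<And>x. ((\<lambda>h. g (x + h *\<^sub>R b)) has_real_derivative g' x) (at 0)"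
  shows "((\<lambda>h. g (x + h *\<^sub>R b)) has_real_derivative g' (x + k *\<^sub>R b)) (at k)"
proof -
  have "((\<lambda>h. g (x + (h + k) *\<^sub>R b)) has_real_derivative g' (x + k *\<^sub>R b)) (at 0)"
    using assms[of "x + k *\<^sub>R b"] by (simp add: algebra_simps)
  then show ?thesis using DERIV_shift[of "\<lambda>h. g (x + h *\<^sub>R b)" _ 0 k] by simp
qed

lemma C12D:
  assumes "C12 w wt wb wbb"
  shows "continuous_on ({0<..} \<times> UNIV) (\<lambda>(t,x). w t x)"
    "continuous_on ({0<..} \<times> UNIV) (\<lambda>(t,x). wt t x)"
    "b \<in> Basis \<Longrightarrow> continuous_on ({0<..} \<times> UNIV) (\<lambda>(t,x). wb b t x)"
    "b \<in> Basis \<Longrightarrow> continuous_on ({0<..} \<times> UNIV) (\<lambda>(t,x). wbb b t x)"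
    "t > 0 \<Longrightarrow> ((\<lambda>s. w s x) has_real_derivative wt t x) (at t)"
    "t > 0 \<Longrightarrow> b \<in> Basis \<Longrightarrow> ((\<lambda>h. w t (x + h *\<^sub>R b)) has_real_derivative wb b t x) (at 0)"
    "t > 0 \<Longrightarrow> b \<in> Basis \<Longrightarrow> ((\<lambda>h. wb b t (x + h *\<^sub>R b)) has_real_derivative wbb b t x) (at 0)"
  using assms unfolding C12_def by simp_all

lemma C12_has_laplacian:
  fixes w :: "real \<Rightarrow> 'a::euclidean_space \<Rightarrow> real"
  assumes "C12 w wt wb wbb" "t > 0"
  shows "has_laplacian (w t) x (\<Sum>b\<in>Basis. wbb b t x)"
  unfolding has_laplacian_def
proof (rule exI[of _ "\<lambda>b h. wb b t (x + h *\<^sub>R b)"], rule exI[of _ "\<lambda>b. wbb b t x"],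
    intro conjI ballI refl)
  fix b :: 'a assume b: "b \<in> Basis"
  have "((\<lambda>h. w t (x + h *\<^sub>R b)) has_real_derivative wb b t (x + h *\<^sub>R b)) (at h)" for h
    using has_real_derivative_along_line[of "w t" b "wb b t", OF C12D(6)[OF assms b]] .
  then show "\<forall>\<^sub>F h in nhds 0. ((\<lambda>h. w t (x + h *\<^sub>R b)) has_real_derivative wb b t (x + h *\<^sub>R b)) (at h)"
    by simp
  show "((\<lambda>h. wb b t (x + h *\<^sub>R b)) has_real_derivative wbb b t x) (at 0)"
    by (rule C12D(7)[OF assms b])
qed

lemma C12_add:
  assumes "C12 w wt wb wbb" "C12 v vt vb vbb"
  shows "C12 (\<lambda>t x. w t x + v t x) (\<lambda>t x. wt t x + vt t x)
     (\<lambda>b t x. wb b t x + vb b t x) (\<lambda>b t x. wbb b t x + vbb b t x)"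
  using assms unfolding C12_def
  by (auto intro!: continuous_intros DERIV_add simp: split_beta)

lemma C12_uminus:
  assumes "C12 w wt wb wbb"
  shows "C12 (\<lambda>t x. - w t x) (\<lambda>t x. - wt t x) (\<lambda>b t x. - wb b t x) (\<lambda>b t x. - wbb b t x)"
  using assms unfolding C12_def
  by (auto intro!: continuous_intros DERIV_minus simp: split_beta)

section \<open>Quadratic barriers\<close>

lemma norm_line_square:
  fixes x :: "'a::euclidean_space"
  assumes "b \<in> Basis"
  shows "(norm (x + h *\<^sub>R b - z))\<^sup>2 = (norm (x - z))\<^sup>2 + 2 * h * ((x - z) \<bullet> b) + h\<^sup>2"
proof -
  define y where "y = x - z"
  have "x + h *\<^sub>R b - z = y + h *\<^sub>R b" by (simp add: y_def)
  moreover have "(norm (y + h *\<^sub>R b))\<^sup>2 = (norm y)\<^sup>2 + 2 * h * (y \<bullet> b) + h\<^sup>2"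
    unfolding power2_norm_eq_inner using assms
    by (simp add: inner_add_left inner_add_right inner_commute power2_eq_square)
  ultimately show ?thesis unfolding y_def by (simp only:)
qed

text \<open>The source of the paraboloid barriers: the Laplacian is the constant
  \<open>2 * B * DIM('a)\<close>, which the drift \<open>m\<close> can be chosen to
  dominate.\<close>

lemma C12_quadratic:
  fixes z :: "'a::euclidean_space"
  shows "C12 (\<lambda>t x. c + B * (norm (x - z))\<^sup>2 + m * t) (\<lambda>t x. m)
     (\<lambda>b t x. 2 * B * ((x - z) \<bullet> b)) (\<lambda>b t x. 2 * B)"
  unfolding C12_def
proof (intro conjI ballI allI impI)
  fix t :: real and x b :: 'a assume b: "b \<in> Basis"
  show "((\<lambda>h. c + B * (norm (x + h *\<^sub>R b - z))\<^sup>2 + m * t) has_real_derivative 2 * B * ((x - z) \<bullet> b)) (at 0)"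
    unfolding norm_line_square[OF b] by (auto intro!: derivative_eq_intros)
  have "(x + h *\<^sub>R b - z) \<bullet> b = (x - z) \<bullet> b + h" for h
    using b by (simp add: inner_simps)
  then show "((\<lambda>h. 2 * B * ((x + h *\<^sub>R b - z) \<bullet> b)) has_real_derivative 2 * B) (at 0)"
    by (auto intro!: derivative_eq_intros)
qed (auto intro!: continuous_intros derivative_eq_intros simp: split_beta)

section \<open>Differentiation under the integral over a box\<close>

lemma continuous_on_shift_Times:
  fixes g :: "real \<Rightarrow> 'a::real_normed_vector \<Rightarrow> real"
  assumes "continuous_on ({0<..} \<times> UNIV) (\<lambda>(t,x). g t x)"
  shows "continuous_on (({0<..} \<times> UNIV) \<times> S) (\<lambda>(p,y). g (fst p) (snd p + y))"
  unfolding split_beta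
  by (rule continuous_on_compose2[OF assms, of _ "\<lambda>q. (fst (fst q), snd (fst q) + snd q)",
        unfolded split_beta fst_conv snd_conv])
     (auto intro!: continuous_intros)

lemma continuous_on_slice:
  fixes g :: "real \<Rightarrow> 'a::real_normed_vector \<Rightarrow> real"
  assumes "continuous_on ({0<..} \<times> UNIV) (\<lambda>(t,x). g t x)" "t > 0"
  shows "continuous_on S (g t)"
  by (rule continuous_on_compose2[OF assms(1), of _ "\<lambda>x. (t, x)", unfolded split_beta fst_conv snd_conv])
     (use assms(2) in \<open>auto intro!: continuous_intros\<close>)

lemma integrable_slice_shift:
  fixes g :: "real \<Rightarrow> 'a::euclidean_space \<Rightarrow> real"
  assumes "continuous_on ({0<..} \<times> UNIV) (\<lambda>(t,x). g t x)" "t > 0"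
  shows "(\<lambda>y. g t (x + y)) integrable_on cbox a c"
  by (intro integrable_continuous continuous_on_compose2[OF continuous_on_slice[OF assms, of UNIV]])
     (auto intro!: continuous_intros)

text \<open>The translation by \<open>x\<close> sits in the integrand over a fixed box, so Leibniz's
  rule applies in time and in each coordinate direction. Hence the heat operator commutes with
  integration over translated boxes.\<close>

lemma C12_box_integral:
  fixes w :: "real \<Rightarrow> 'a::euclidean_space \<Rightarrow> real" and a c :: 'a
  assumes "C12 w wt wb wbb"
  defines "I \<equiv> \<lambda>(g::real \<Rightarrow> 'a \<Rightarrow> real) t x. integral (cbox a c) (\<lambda>y. g t (x + y))"
  shows "C12 (I w) (I wt) (\<lambda>b. I (wb b)) (\<lambda>b. I (wbb b))"
proof -
  note A = assms(1)[unfolded C12_def]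
  have cont: "continuous_on ({0<..} \<times> UNIV) (\<lambda>(t,x). I g t x)"
    if "continuous_on ({0<..} \<times> UNIV) (\<lambda>(t,x). g t x)" for g
    unfolding I_def split_beta
    by (rule integral_continuous_on_param[OF continuous_on_shift_Times[OF that]])
  have time: "((\<lambda>s. I w s x) has_real_derivative I wt t x) (at t)" if t: "t > 0" for t x
  proof -
    have "((\<lambda>s. I w s x) has_real_derivative I wt t x) (at t within {0<..})"
      unfolding I_def
    proof (rule leibniz_rule_field_derivative)
      show "((\<lambda>s. w s (x + y)) has_real_derivative wt s (x + y)) (at s within {0<..})"
        if "s \<in> {0<..}" for s y
        using A that by (auto intro: has_field_derivative_at_within)
      show "(\<lambda>y. w s (x + y)) integrable_on cbox a c" if "s \<in> {0<..}" for s
        using A that by (intro integrable_slice_shift) auto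
      have c: "continuous_on ({0<..} \<times> UNIV) (\<lambda>(t,x). wt t x)" using A by blast
      show "continuous_on ({0<..} \<times> cbox a c) (\<lambda>(s, y). wt s (x + y))"
        unfolding split_beta
        by (rule continuous_on_compose2[OF c, of _ "\<lambda>q. (fst q, x + snd q)",
              unfolded split_beta fst_conv snd_conv]) (auto intro!: continuous_intros)
    qed (use t in auto)
    then show ?thesis using t by (simp add: at_within_open[of t "{0<..}"])
  qed
  \<comment> \<open>Serves twice: for \<open>w\<close> with derivative \<open>wb b\<close>, and for
    \<open>wb b\<close> with derivative \<open>wbb b\<close>.\<close>
  have space: "((\<lambda>h. I g t (x + h *\<^sub>R b)) has_real_derivative I g' t x) (at 0)"
    if t: "t > 0" and c: "continuous_on ({0<..} \<times> UNIV) (\<lambda>(t,x). g t x)"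
      and c': "continuous_on ({0<..} \<times> UNIV) (\<lambda>(t,x). g' t x)"
      and d: "\<And>x. ((\<lambda>h. g t (x + h *\<^sub>R b)) has_real_derivative g' t x) (at 0)" for t x b g g'
  proof -
    have "((\<lambda>h. integral (cbox a c) (\<lambda>y. g t (x + h *\<^sub>R b + y))) has_real_derivative
       integral (cbox a c) (\<lambda>y. g' t (x + 0 *\<^sub>R b + y))) (at 0 within UNIV)"
    proof (rule leibniz_rule_field_derivative)
      show "((\<lambda>h. g t (x + h *\<^sub>R b + y)) has_real_derivative g' t (x + h *\<^sub>R b + y)) (at h within UNIV)"
        for h y
        using has_real_derivative_along_line[of "g t" b "g' t" "x + y" h, OF d]
        by (simp add: algebra_simps)
      show "(\<lambda>y. g t (x + h *\<^sub>R b + y)) integrable_on cbox a c" for h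
        using c t by (rule integrable_slice_shift)
      show "continuous_on (UNIV \<times> cbox a c) (\<lambda>(h, y). g' t (x + h *\<^sub>R b + y))"
        unfolding split_beta
        by (rule continuous_on_compose2[OF continuous_on_slice[OF c' t, of UNIV]])
           (auto intro!: continuous_intros)
    qed auto
    then show ?thesis by (simp add: I_def)
  qed
  show ?thesis
    unfolding C12_def
    using A cont time space by (auto simp del: split_paired_All)
qed

subsection \<open>Lower bounds from an initial trace\<close>

lemma norm_le_in_cube:
  fixes y :: "'a::euclidean_space" and h :: real
  assumes "y \<in> cbox (- (h *\<^sub>R One)) (h *\<^sub>R One)"
  shows "norm y \<le> real DIM('a) * h"
proof -
  have "\<bar>y \<bullet> b\<bar> \<le> h" if "b \<in> Basis" for b
    using assms that by (force simp: mem_box abs_le_iff)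
  then have "(\<Sum>b\<in>Basis. \<bar>y \<bullet> b\<bar>) \<le> real DIM('a) * h"
    using sum_bounded_above[of Basis "\<lambda>b. \<bar>y \<bullet> b\<bar>" h] by simp
  then show ?thesis using norm_le_l1[of y] by linarith
qed

text \<open>Cube integrals of \<open>d\<close> satisfy a strict inequality of the same kind, and at
  small times they are bounded below by a small negative number uniformly in the centre, since one
  large box contains all the cubes. The minimum principle makes them nonnegative; shrinking the cube
  gives the pointwise claim.\<close>

lemma nonneg_of_L1_trace:
  fixes d :: "real \<Rightarrow> 'a::euclidean_space \<Rightarrow> real"
  assumes C: "C12 d dt db dbb" and "\<beta> > 0"
    and super: "\<And>t x. t > 0 \<Longrightarrow> dt t x - (\<Sum>b\<in>Basis. dbb b t x) \<ge> \<beta>"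
    and far: "\<And>t x. 0 < t \<Longrightarrow> t \<le> T \<Longrightarrow> norm x \<ge> R \<Longrightarrow> 0 \<le> d t x"
    and init: "\<And>a c. ((\<lambda>t. integral (cbox a c) (\<lambda>x. max 0 (- d t x))) \<longlongrightarrow> 0) (at_right 0)"
    and t: "0 < t" "t \<le> T"
  shows "0 \<le> d t x"
proof (rule ccontr)
  note cd = C12D(1)[OF C] and cdt = C12D(2)[OF C] and cdbb = C12D(4)[OF C]
  have cm: "continuous_on ({0<..} \<times> UNIV) (\<lambda>(t,x). max 0 (- d t x))"
    using cd unfolding split_beta by (intro continuous_intros)
  have cube: "0 \<le> integral (cbox (- (h *\<^sub>R One)) (h *\<^sub>R One)) (\<lambda>y. d t (x + y))" if h: "h > 0" for h
  proof (rule field_le_epsilon)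
    fix \<eta> :: real assume \<eta>: "\<eta> > 0"
    define Q :: "'a set" where "Q = cbox (- (h *\<^sub>R One)) (h *\<^sub>R One)"
    define S where "S = real DIM('a) * h"
    have S: "norm y \<le> S" if "y \<in> Q" for y
      using norm_le_in_cube that unfolding Q_def S_def by blast
    have "measure lborel Q > 0" unfolding Q_def using h by (intro content_pos_lt) auto
    \<comment> \<open>Cubes centred on the sphere of radius \<open>R1\<close> lie where
      \<open>far\<close> applies, and the ball of radius \<open>R1\<close> contains
      \<open>x\<close>.\<close>
    define R1 where "R1 = max (\<bar>R\<bar> + S) (norm x)"
    obtain a c :: 'a where ac: "cball 0 (R1 + S) \<subseteq> cbox a c"
      using bounded_subset_cbox_symmetric[OF bounded_cball] by metis
    have "\<forall>\<^sub>F s in at_right 0. integral (cbox a c) (\<lambda>x. max 0 (- d s x)) < \<eta>"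
      using order_tendstoD(2)[OF init \<eta>] by simp
    moreover have "\<forall>\<^sub>F s in at_right 0. 0 < s \<and> s < t"
      using t by (auto intro: eventually_at_rightI)
    ultimately have "\<forall>\<^sub>F s in at_right 0. integral (cbox a c) (\<lambda>x. max 0 (- d s x)) < \<eta> \<and> 0 < s \<and> s < t"
      by (rule eventually_conj)
    then obtain s where s: "integral (cbox a c) (\<lambda>x. max 0 (- d s x)) < \<eta>" "0 < s" "s < t"
      using eventually_happens'[of "at_right (0::real)"] trivial_limit_at_right_real by blast
    define I where "I = (\<lambda>(g::real \<Rightarrow> 'a \<Rightarrow> real) t x. integral Q (\<lambda>y. g t (x + y)))"
    have "C12 (I d) (I dt) (\<lambda>b. I (db b)) (\<lambda>b. I (dbb b))"
      unfolding I_def Q_def by (rule C12_box_integral[OF C])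
    from C12_add[OF this C12_quadratic[of \<eta> 0 0 0]]
    have CI: "C12 (\<lambda>t x. I d t x + \<eta>) (I dt) (\<lambda>b. I (db b)) (\<lambda>b. I (dbb b))"
      by simp
    have ii: "(\<lambda>y. g r (z + y)) integrable_on Q"
      if "r > 0" "continuous_on ({0<..} \<times> UNIV) (\<lambda>(t,x). g t x)"
      for g :: "real \<Rightarrow> 'a \<Rightarrow> real" and r z
      unfolding Q_def by (rule integrable_slice_shift[OF that(2,1)])
    have "0 \<le> I d t x + \<eta>"
    \<comment> \<open>Starting at \<open>s > 0\<close> gives continuity up to the initial time, and
      the slack \<open>\<eta>\<close> absorbs the defect there. With \<open>K = 0\<close>,
      strictness comes from \<open>\<beta>\<close> times the volume of the cube.\<close>
    proof (rule parabolic_minimum_principle[of s T 0 R1 "\<lambda>t x. I d t x + \<eta>" 0])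
      show "continuous_on ({s..T} \<times> cball 0 R1) (\<lambda>(t,x). I d t x + \<eta>)"
        using s by (intro continuous_on_subset[OF C12D(1)[OF CI]]) auto
      show "0 \<le> I d s z + \<eta>" if z: "z \<in> cball 0 R1" for z
      proof -
        have "cbox (- (h *\<^sub>R One) + z) (h *\<^sub>R One + z) \<subseteq> cball 0 (R1 + S)"
        proof
          fix y assume "y \<in> cbox (- (h *\<^sub>R One) + z) (h *\<^sub>R One + z)"
          then have "y - z \<in> Q" by (force simp: Q_def mem_box algebra_simps)
          then have "norm (y - z) \<le> S" by (rule S)
          then show "y \<in> cball 0 (R1 + S)" using z norm_triangle_sub[of y z] by auto
        qed
        then have sub: "cbox (- (h *\<^sub>R One) + z) (h *\<^sub>R One + z) \<subseteq> cbox a c" using ac by blast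
        have "- I d s z = integral Q (\<lambda>y. - d s (z + y))" by (simp add: I_def)
        also have "\<dots> \<le> integral Q (\<lambda>y. max 0 (- d s (z + y)))"
          using s ii[OF s(2) cd] ii[OF s(2) cm] by (intro integral_le) (auto intro: integrable_neg)
        also have "\<dots> = integral (cbox (- (h *\<^sub>R One) + z) (h *\<^sub>R One + z)) (\<lambda>y. max 0 (- d s y))"
          using integral_shift_cbox_plus[of _ _ "\<lambda>y. max 0 (- d s y)" z] by (simp add: Q_def o_def)
        also have "\<dots> \<le> integral (cbox a c) (\<lambda>y. max 0 (- d s y))"
          using sub s continuous_on_slice[OF cm s(2)]
          by (intro integral_subset_le integrable_continuous) auto
        finally show ?thesis using s by linarith
      qed
      show "0 \<le> I d r z + \<eta>" if r: "s \<le> r" "r \<le> T" "dist 0 z = R1" for r z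
      proof -
        have "0 \<le> d r (z + y)" if "y \<in> Q" for y
          using S[OF that] r s norm_diff_ineq[of z y] by (intro far) (auto simp: R1_def)
        then have "0 \<le> I d r z" unfolding I_def by (intro integral_nonneg ii cd) (use r s in auto)
        then show ?thesis using \<eta> by simp
      qed
      show "\<exists>vt l. ((\<lambda>s. I d s z + \<eta>) has_real_derivative vt) (at r) \<and>
          has_laplacian (\<lambda>x. I d r x + \<eta>) z l \<and> vt - l > 0 * (I d r z + \<eta>)"
        if r: "s < r" "r \<le> T" for r z
      proof (intro exI conjI)
        have r0: "r > 0" using r s by simp
        show "((\<lambda>s. I d s z + \<eta>) has_real_derivative I dt r z) (at r)"
          by (rule C12D(5)[OF CI r0])
        show "has_laplacian (\<lambda>x. I d r x + \<eta>) z (\<Sum>b\<in>Basis. I (dbb b) r z)"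
          using C12_has_laplacian[OF CI r0] .
        have "I dt r z - (\<Sum>b\<in>Basis. I (dbb b) r z)
            = integral Q (\<lambda>y. dt r (z + y) - (\<Sum>b\<in>Basis. dbb b r (z + y)))"
          unfolding I_def using ii[OF r0 cdt] ii[OF r0 cdbb]
          by (simp add: integral_diff integral_sum integrable_sum)
        also have "\<dots> \<ge> integral Q (\<lambda>y. \<beta>)"
          using super r0 ii[OF r0 cdt] ii[OF r0 cdbb]
          by (intro integral_le integrable_diff integrable_sum) (auto simp: Q_def)
        also have "integral Q (\<lambda>y. \<beta>) = measure lborel Q * \<beta>" by (simp add: Q_def)
        finally show "I dt r z - (\<Sum>b\<in>Basis. I (dbb b) r z) > 0 * (I d r z + \<eta>)"
          using \<open>\<beta> > 0\<close> \<open>measure lborel Q > 0\<close> by (smt (verit) mult_pos_pos mult_zero_left)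
      qed
    qed (use s t in \<open>auto simp: R1_def\<close>)
    then show "0 \<le> integral (cbox (- (h *\<^sub>R One)) (h *\<^sub>R One)) (\<lambda>y. d t (x + y)) + \<eta>"
      by (simp add: I_def Q_def)
  qed
  assume "\<not> 0 \<le> d t x"
  then have neg: "d t x < 0" by simp
  have "isCont (d t) x"
    using continuous_on_slice[OF cd t(1), of UNIV] by (simp add: continuous_on_eq_continuous_at)
  then have "\<exists>\<delta>>0. \<forall>y. dist y x < \<delta> \<longrightarrow> dist (d t y) (d t x) < - d t x / 2"
    using neg unfolding continuous_at_eps_delta by (metis half_gt_zero neg_0_less_iff_less)
  then obtain \<delta> where \<delta>: "\<delta> > 0" "\<And>y. dist y x < \<delta> \<Longrightarrow> dist (d t y) (d t x) < - d t x / 2"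
    by blast
  \<comment> \<open>Keeps the cube inside the \<open>\<delta>\<close>-ball, where \<open>d t\<close>
    stays below half of its negative value at \<open>x\<close>.\<close>
  define h where "h = \<delta> / (2 * real DIM('a))"
  have h: "h > 0" "real DIM('a) * h < \<delta>" using \<delta> by (auto simp: h_def)
  let ?Q = "cbox (- (h *\<^sub>R One)) (h *\<^sub>R One) :: 'a set"
  have "measure lborel ?Q > 0" using h by (intro content_pos_lt) auto
  have le: "d t (x + y) \<le> d t x / 2" if "y \<in> ?Q" for y
  proof -
    have "dist (x + y) x < \<delta>" using norm_le_in_cube[OF that] h by (simp add: dist_norm)
    from \<delta>(2)[OF this] show ?thesis by (simp add: dist_real_def abs_if split: if_splits)
  qed
  have "integral ?Q (\<lambda>y. d t (x + y)) \<le> integral ?Q (\<lambda>y. d t x / 2)"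
    using le by (intro integral_le integrable_slice_shift[OF cd t(1)]) auto
  also have "\<dots> = measure lborel ?Q * (d t x / 2)" by simp
  also have "\<dots> < 0" using \<open>measure lborel ?Q > 0\<close> neg by (intro mult_pos_neg) auto
  finally show False using cube[OF h(1)] by simp
qed

text \<open>A paraboloid with vertex at \<open>z\<close> lies below \<open>w0\<close> and sinks at a
  constant speed. That speed pays \<open>2 * B * DIM('a)\<close> for its Laplacian, \<open>F\<close>
  for the source and an extra \<open>B\<close> for strictness; the bound is read off at the
  vertex.\<close>

lemma lower_bound_from_L1_trace:
  fixes w :: "real \<Rightarrow> 'a::euclidean_space \<Rightarrow> real"
  assumes C: "C12 w wt wb wbb"
    and M: "\<And>t x. t > 0 \<Longrightarrow> - M \<le> w t x"
    and super: "\<And>t x. t > 0 \<Longrightarrow> wt t x - (\<Sum>b\<in>Basis. wbb b t x) \<ge> - F"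
    and init: "\<And>a c. ((\<lambda>t. integral (cbox a c) (\<lambda>x. \<bar>w t x - w0 x\<bar>)) \<longlongrightarrow> 0) (at_right 0)"
    and int: "\<And>t a c. t > 0 \<Longrightarrow> (\<lambda>x. \<bar>w t x - w0 x\<bar>) integrable_on cbox a c"
    and w0: "\<And>x. A - B * (norm (x - z))\<^sup>2 \<le> w0 x"
    and pos: "B > 0" "F \<ge> 0" "t > 0"
  shows "A - (B * (2 * real DIM('a) + 1) + F) * t \<le> w t z"
proof -
  define m where "m = B * (2 * real DIM('a) + 1) + F"
  have m: "m \<ge> 0" using pos by (simp add: m_def)
  define d where "d = (\<lambda>t x. w t x + (- A + B * (norm (x - z))\<^sup>2 + m * t))"
  have Cd: "C12 d (\<lambda>t x. wt t x + m) (\<lambda>b t x. wb b t x + 2 * B * ((x - z) \<bullet> b)) (\<lambda>b t x. wbb b t x + 2 * B)"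
    unfolding d_def by (rule C12_add[OF C C12_quadratic])
  have cd: "continuous_on ({0<..} \<times> UNIV) (\<lambda>(t,x). max 0 (- d t x))"
    using C12D(1)[OF Cd] unfolding split_beta by (intro continuous_intros)
  have "0 \<le> d t z"
  \<comment> \<open>Outside this radius \<open>B * (norm (x - z))\<^sup>2\<close> exceeds
    \<open>\<bar>M\<bar> + \<bar>A\<bar>\<close>, so the paraboloid is below the lower bound
    \<open>- M\<close>.\<close>
  proof (rule nonneg_of_L1_trace[OF Cd \<open>B > 0\<close>, of t "norm z + 1 + (\<bar>M\<bar> + \<bar>A\<bar>) / B"])
    show "B \<le> wt t x + m - (\<Sum>b\<in>Basis. wbb b t x + 2 * B)" if "t > 0" for t x
      using super[OF that, of x] by (simp add: m_def sum.distrib algebra_simps)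
    show "0 \<le> d s x" if s: "0 < s" "norm x \<ge> norm z + 1 + (\<bar>M\<bar> + \<bar>A\<bar>) / B" for s x
    proof -
      let ?q = "(\<bar>M\<bar> + \<bar>A\<bar>) / B"
      have q: "?q \<ge> 0" using pos by simp
      have n: "norm (x - z) \<ge> 1 + ?q" using s norm_triangle_ineq2[of x z] by linarith
      have "?q \<le> (1 + ?q) * 1" by simp
      also have "\<dots> \<le> (1 + ?q) * (1 + ?q)" using q by (intro mult_left_mono) auto
      also have "\<dots> \<le> norm (x - z) * norm (x - z)" using n q by (intro mult_mono) auto
      finally have "B * ?q \<le> B * (norm (x - z))\<^sup>2"
        using pos by (intro mult_left_mono) (auto simp: power2_eq_square)
      then have "\<bar>M\<bar> + \<bar>A\<bar> \<le> B * (norm (x - z))\<^sup>2" using pos by simp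
      moreover have "0 \<le> m * s" using m s by simp
      ultimately show ?thesis using M[OF s(1), of x] unfolding d_def by linarith
    qed
    fix a c :: 'a
    show "((\<lambda>t. integral (cbox a c) (\<lambda>x. max 0 (- d t x))) \<longlongrightarrow> 0) (at_right 0)"
    proof (rule tendsto_sandwich[OF _ _ tendsto_const init[of a c]])
      have p: "\<forall>\<^sub>F s in at_right 0. 0 < (s::real)" by (rule eventually_at_right_less)
      have i: "(\<lambda>x. max 0 (- d s x)) integrable_on cbox a c" if "s > 0" for s
        by (intro integrable_continuous continuous_on_slice[OF cd that])
      show "\<forall>\<^sub>F s in at_right 0. 0 \<le> integral (cbox a c) (\<lambda>x. max 0 (- d s x))"
        using p by eventually_elim (auto intro!: integral_nonneg i)
      show "\<forall>\<^sub>F s in at_right 0. integral (cbox a c) (\<lambda>x. max 0 (- d s x))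
          \<le> integral (cbox a c) (\<lambda>x. \<bar>w s x - w0 x\<bar>)"
        using p
      proof eventually_elim
        case (elim s)
        show ?case
        proof (rule integral_le[OF i int])
          fix x
          have "0 \<le> m * s" using m elim by simp
          \<comment> \<open>As \<open>w0\<close> dominates the paraboloid, the negative part of
            \<open>d\<close> is at most the deviation of \<open>w\<close> from its trace.\<close>
          then show "max 0 (- d s x) \<le> \<bar>w s x - w0 x\<bar>" using w0[of x] unfolding d_def by linarith
        qed (use elim in auto)
      qed
    qed
  qed (use pos in auto)
  then show ?thesis unfolding d_def m_def by simp
qed

subsection \<open>The moving bump\<close>

text \<open>With \<open>q\<close> the bracket, the squared gradient of \<open>q\<close> is
  \<open>4 * (1 - q) / \<rho>\<^sup>2\<close> and its Laplacian is
  \<open>- 2 * DIM('a) / \<rho>\<^sup>2\<close>; the Laplacian of \<open>q\<^sup>2\<close> is twice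
  the former plus \<open>2 * q\<close> times the latter.\<close>

lemma has_laplacian_bump:
  fixes x z :: "'a::euclidean_space"
  assumes "\<rho> > 0"
  shows "has_laplacian (\<lambda>y. m * (1 - (norm (y - z))\<^sup>2 / \<rho>\<^sup>2)\<^sup>2) x
    (m / \<rho>\<^sup>2 * (8 - (4 * real DIM('a) + 8) * (1 - (norm (x - z))\<^sup>2 / \<rho>\<^sup>2)))"
proof -
  define n where "n = (norm (x - z))\<^sup>2"
  define q where "q = 1 - n / \<rho>\<^sup>2"
  define c where "c = (\<lambda>b. (x - z) \<bullet> b)"
  \<comment> \<open>Treating the inverse as an opaque constant keeps division out of the derivative
    rules and leaves polynomial algebra.\<close>
  define i where "i = inverse (\<rho>\<^sup>2)"
  have i4: "inverse (\<rho>^4) = i * i"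
    by (simp add: i_def power4_eq_xxxx power2_eq_square)
  have n: "n = (\<Sum>b\<in>Basis. (c b)\<^sup>2)"
    unfolding n_def c_def power2_norm_eq_inner by (subst euclidean_inner) (simp add: power2_eq_square)
  have sum: "m / \<rho>\<^sup>2 * (8 - (4 * real DIM('a) + 8) * q) = (\<Sum>b\<in>Basis. m * (8 * (c b)\<^sup>2 / \<rho>^4 - 4 * q / \<rho>\<^sup>2))"
  proof -
    have "(\<Sum>b\<in>Basis. m * (8 * (c b)\<^sup>2 / \<rho>^4 - 4 * q / \<rho>\<^sup>2))
        = m * (8 * n / \<rho>^4 - real DIM('a) * (4 * q / \<rho>\<^sup>2))"
      by (simp add: sum_distrib_left[symmetric] sum_subtractf sum_divide_distrib[symmetric] n)
    also have "8 * n / \<rho>^4 = 8 * (1 - q) / \<rho>\<^sup>2"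
      unfolding q_def using assms by (simp add: field_simps power4_eq_xxxx power2_eq_square)
    also have "m * (8 * (1 - q) / \<rho>\<^sup>2 - real DIM('a) * (4 * q / \<rho>\<^sup>2))
        = m / \<rho>\<^sup>2 * (8 - (4 * real DIM('a) + 8) * q)"
      by (simp add: diff_divide_distrib algebra_simps)
    finally show ?thesis by (rule sym)
  qed
  have "has_laplacian (\<lambda>y. m * (1 - (norm (y - z))\<^sup>2 / \<rho>\<^sup>2)\<^sup>2) x
    (\<Sum>b\<in>Basis. m * (8 * (c b)\<^sup>2 / \<rho>^4 - 4 * q / \<rho>\<^sup>2))"
    unfolding has_laplacian_def
  proof (rule exI[of _ "\<lambda>b h. m * (2 * (1 - (n + 2 * h * c b + h\<^sup>2) / \<rho>\<^sup>2) * (- (2 * c b + 2 * h) / \<rho>\<^sup>2))"],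
      rule exI[of _ "\<lambda>b. m * (8 * (c b)\<^sup>2 / \<rho>^4 - 4 * q / \<rho>\<^sup>2)"], intro conjI ballI refl)
    fix b :: 'a assume b: "b \<in> Basis"
    have "((\<lambda>h. m * (1 - (norm (x + h *\<^sub>R b - z))\<^sup>2 / \<rho>\<^sup>2)\<^sup>2) has_real_derivative
        m * (2 * (1 - (n + 2 * h * c b + h\<^sup>2) / \<rho>\<^sup>2) * (- (2 * c b + 2 * h) / \<rho>\<^sup>2))) (at h)" for h
      unfolding norm_line_square[OF b] n_def[symmetric] c_def[symmetric]
        divide_inverse i_def[symmetric]
      by (rule derivative_eq_intros refl)+ (simp add: algebra_simps)
    then show "\<forall>\<^sub>F h in nhds 0. ((\<lambda>h. m * (1 - (norm (x + h *\<^sub>R b - z))\<^sup>2 / \<rho>\<^sup>2)\<^sup>2) has_real_derivative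
        m * (2 * (1 - (n + 2 * h * c b + h\<^sup>2) / \<rho>\<^sup>2) * (- (2 * c b + 2 * h) / \<rho>\<^sup>2))) (at h)"
      by simp
    show "((\<lambda>h. m * (2 * (1 - (n + 2 * h * c b + h\<^sup>2) / \<rho>\<^sup>2) * (- (2 * c b + 2 * h) / \<rho>\<^sup>2)))
        has_real_derivative m * (8 * (c b)\<^sup>2 / \<rho>^4 - 4 * q / \<rho>\<^sup>2)) (at 0)"
      unfolding q_def divide_inverse i4 i_def[symmetric]
      by (rule derivative_eq_intros refl)+ (simp add: algebra_simps power2_eq_square)
  qed
  then show ?thesis unfolding sum[symmetric] unfolding q_def n_def .
qed

text \<open>The split is at \<open>q = 1 / (N + 2)\<close>. Below it the bracket is at least 4;
  above it the bracket is at least \<open>- 4 * N\<close>, and the reaction at height at least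
  \<open>a / (N + 2)\<^sup>2\<close> wins. Since \<open>a powr (p - 1)\<close> increases with
  \<open>a\<close>, the condition \<open>big\<close> at \<open>a0\<close> covers all larger
  amplitudes. The uniform margin \<open>\<kappa>\<close> is what growth and motion of the bump will
  spend.\<close>

lemma bump_strict_subsolution:
  fixes f :: "real \<Rightarrow> real"
  assumes "p > 1" "c > 0" and low: "\<And>u. 0 < u \<Longrightarrow> u \<le> a1 \<Longrightarrow> c * u powr p \<le> f u"
    and nn: "\<And>u. f u \<ge> 0" and "0 < a0" "\<rho> > 0" and N: "N \<ge> (0::real)"
    and big: "c * a0 powr (p - 1) * (1 / (N + 2)\<^sup>2) powr p > 4 * N / \<rho>\<^sup>2"
  shows "\<exists>\<kappa>>0. \<forall>a q. a0 \<le> a \<longrightarrow> a \<le> a1 \<longrightarrow> 0 < q \<longrightarrow> q \<le> 1 \<longrightarrow>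
     \<kappa> \<le> a / \<rho>\<^sup>2 * (8 - (4 * N + 8) * q) + f (a * q\<^sup>2)"
proof -
  define G where "G = (1 / (N + 2)\<^sup>2) powr p"
  define \<kappa>1 where "\<kappa>1 = a0 / \<rho>\<^sup>2 * 4"
  define \<kappa>2 where "\<kappa>2 = a0 * (c * a0 powr (p - 1) * G - 4 * N / \<rho>\<^sup>2)"
  have pos: "\<kappa>1 > 0" "\<kappa>2 > 0" using assms unfolding \<kappa>1_def \<kappa>2_def G_def by simp_all
  have "min \<kappa>1 \<kappa>2 \<le> a / \<rho>\<^sup>2 * (8 - (4 * N + 8) * q) + f (a * q\<^sup>2)"
    if a: "a0 \<le> a" "a \<le> a1" and q: "0 < q" "q \<le> 1" for a q
  proof (cases "q \<le> 1 / (N + 2)")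
    case True
    have "(4 * N + 8) * q \<le> (4 * N + 8) * (1 / (N + 2))" using True N by (intro mult_left_mono) auto
    also have "\<dots> = 4" using N by (simp add: field_simps)
    finally have 4: "8 - (4 * N + 8) * q \<ge> 4" by simp
    have "\<kappa>1 \<le> a / \<rho>\<^sup>2 * 4" unfolding \<kappa>1_def using a assms by (simp add: divide_right_mono)
    also have "\<dots> \<le> a / \<rho>\<^sup>2 * (8 - (4 * N + 8) * q)"
      using 4 a assms by (intro mult_left_mono) auto
    finally show ?thesis using nn[of "a * q\<^sup>2"] by linarith
  next
    case False
    have a_pos: "a > 0" using a assms by simp
    have "(1 / (N + 2))\<^sup>2 \<le> q\<^sup>2" using False N by (intro power_mono) auto
    then have aq: "a * (1 / (N + 2)\<^sup>2) \<le> a * q\<^sup>2"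
      using a_pos by (intro mult_left_mono) (auto simp: power_divide)
    have "q\<^sup>2 \<le> 1" using q by (simp add: power_le_one)
    then have "a * q\<^sup>2 \<le> a1" using a a_pos mult_left_le[of "q\<^sup>2" a] by linarith
    then have "f (a * q\<^sup>2) \<ge> c * (a * q\<^sup>2) powr p" using low a_pos q by simp
    moreover have "(a * q\<^sup>2) powr p \<ge> (a * (1 / (N + 2)\<^sup>2)) powr p"
      using aq a_pos N assms by (intro powr_mono2) auto
    moreover have "(a * (1 / (N + 2)\<^sup>2)) powr p = a powr p * G"
      unfolding G_def by (rule powr_mult)
    moreover have "a powr p = a * a powr (p - 1)"
      using a_pos by (simp add: powr_mult_base)
    ultimately have f1: "f (a * q\<^sup>2) \<ge> c * (a * a powr (p - 1) * G)"
      using \<open>c > 0\<close> by (smt (verit) mult_left_mono)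
    have "a0 powr (p - 1) \<le> a powr (p - 1)" using a assms by (intro powr_mono2) auto
    then have "c * a0 powr (p - 1) * G \<le> c * a powr (p - 1) * G"
      using \<open>c > 0\<close> by (intro mult_right_mono mult_left_mono) (auto simp: G_def)
    then have "\<kappa>2 \<le> a * (c * a powr (p - 1) * G - 4 * N / \<rho>\<^sup>2)"
      unfolding \<kappa>2_def using a assms big[folded G_def] by (intro mult_mono) auto
    also have "\<dots> = c * (a * a powr (p - 1) * G) + a / \<rho>\<^sup>2 * (- 4 * N)" by (simp add: algebra_simps)
    also have "\<dots> \<le> f (a * q\<^sup>2) + a / \<rho>\<^sup>2 * (8 - (4 * N + 8) * q)"
    proof (intro add_mono f1 mult_left_mono)
      have "(4 * N + 8) * q \<le> (4 * N + 8) * 1" using q N by (intro mult_left_mono) auto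
      then show "- 4 * N \<le> 8 - (4 * N + 8) * q" by simp
    qed (use a_pos in auto)
    finally show ?thesis by linarith
  qed
  then show ?thesis using pos by (intro exI[of _ "min \<kappa>1 \<kappa>2"]) auto
qed

lemma norm_moving_square:
  fixes y e :: "'a::real_inner"
  shows "(norm (y - \<tau> *\<^sub>R e))\<^sup>2 = (norm y)\<^sup>2 - 2 * \<tau> * (y \<bullet> e) + \<tau>\<^sup>2 * (norm e)\<^sup>2"
  unfolding power2_norm_eq_inner
  by (simp add: inner_diff_left inner_diff_right inner_commute power2_eq_square)

text \<open>The margin \<open>\<kappa>\<close> pays \<open>k\<close> for the growth of the amplitude
  and \<open>4 * a1 * norm e / \<rho>\<close> for moving the centre with velocity \<open>e\<close>.
  The bump is extended by 0; since \<open>u\<close> is nonnegative, \<open>u < v\<close> can occur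
  only inside the support, where \<open>v\<close> is a polynomial.\<close>

lemma moving_bump_comparison:
  fixes u :: "real \<Rightarrow> 'a::euclidean_space \<Rightarrow> real"
  assumes C: "C12 u ut ub ubb"
    and eq: "\<And>t x. t > 0 \<Longrightarrow> ut t x - (\<Sum>b\<in>Basis. ubb b t x) = f (u t x)"
    and nonneg: "\<And>t x. t > 0 \<Longrightarrow> 0 \<le> u t x"
    and lip: "\<And>v w. 0 \<le> v \<Longrightarrow> v \<le> 1 \<Longrightarrow> 0 \<le> w \<Longrightarrow> w \<le> 1 \<Longrightarrow> \<bar>f v - f w\<bar> \<le> K * \<bar>v - w\<bar>"
    and strict: "\<And>a q. a0 \<le> a \<Longrightarrow> a \<le> a1 \<Longrightarrow> 0 < q \<Longrightarrow> q \<le> 1 \<Longrightarrow>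
        \<kappa> \<le> a / \<rho>\<^sup>2 * (8 - (4 * real DIM('a) + 8) * q) + f (a * q\<^sup>2)"
    and a: "0 \<le> a0" "a1 \<le> 1" "a0 + k * (T' - T) \<le> a1" "k \<ge> 0" "k + 4 * a1 * norm e / \<rho> < \<kappa>"
    and pos: "\<rho> > 0" "T > 0" "T \<le> T'"
    and init: "\<And>x. x \<in> ball z \<rho> \<Longrightarrow> a0 * (1 - (norm (x - z))\<^sup>2 / \<rho>\<^sup>2)\<^sup>2 \<le> u T x"
    and x: "x \<in> ball (z + (T' - T) *\<^sub>R e) \<rho>"
  shows "(a0 + k * (T' - T)) * (1 - (norm (x - (z + (T' - T) *\<^sub>R e)))\<^sup>2 / \<rho>\<^sup>2)\<^sup>2 \<le> u T' x"
proof -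
  define \<xi> where "\<xi> = (\<lambda>t. z + (t - T) *\<^sub>R e)"
  define q where "q = (\<lambda>t x. 1 - (norm (x - \<xi> t))\<^sup>2 / \<rho>\<^sup>2)"
  define A where "A = (\<lambda>t. a0 + k * (t - T))"
  define v where "v = (\<lambda>t x. A t * (max 0 (q t x))\<^sup>2)"
  \<comment> \<open>A fixed ball containing the moving support throughout \<open>{T..T'}\<close>, so
    \<open>v\<close> vanishes on its boundary.\<close>
  define R where "R = \<rho> + (T' - T) * norm e"
  have q_le: "q t y \<le> 1" for t y by (simp add: q_def)
  have q_pos: "q t y > 0 \<longleftrightarrow> norm (y - \<xi> t) < \<rho>" for t y
  proof -
    have "q t y > 0 \<longleftrightarrow> (norm (y - \<xi> t))\<^sup>2 < \<rho>\<^sup>2" using pos by (simp add: q_def)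
    also have "\<dots> \<longleftrightarrow> norm (y - \<xi> t) < \<rho>"
      using pos power2_less_imp_less[of "norm (y - \<xi> t)" \<rho>]
        power_strict_mono[of "norm (y - \<xi> t)" \<rho> 2] by auto
    finally show ?thesis .
  qed
  have A_bd: "a0 \<le> A t" "A t \<le> a1" if "T \<le> t" "t \<le> T'" for t
  proof -
    show "a0 \<le> A t" using that a by (simp add: A_def)
    have "k * (t - T) \<le> k * (T' - T)" using that a by (intro mult_left_mono) auto
    then show "A t \<le> a1" using a by (simp add: A_def)
  qed
  have contq: "continuous_on S (\<lambda>(t,y). q t y)" for S
    unfolding q_def \<xi>_def split_beta using pos by (intro continuous_intros) auto
  have dv: "x \<in> cball z R"
  proof -
    have "norm (x - z) \<le> norm (x - (z + (T' - T) *\<^sub>R e)) + norm ((T' - T) *\<^sub>R e)"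
      using norm_triangle_ineq[of "x - (z + (T' - T) *\<^sub>R e)" "(T' - T) *\<^sub>R e"] by simp
    also have "\<dots> \<le> R" using x pos unfolding R_def by (simp add: dist_norm norm_minus_commute)
    finally show ?thesis by (simp add: dist_norm norm_minus_commute)
  qed
  have "0 \<le> u T' x - v T' x"
  proof (rule parabolic_minimum_principle[of T T' z R "\<lambda>t x. u t x - v t x" K, OF _ _ _ _ _ _ dv])
    have "continuous_on ({T..T'} \<times> cball z R) (\<lambda>(t,x). u t x)"
      by (rule continuous_on_subset[OF C12D(1)[OF C]]) (use pos in auto)
    then show "continuous_on ({T..T'} \<times> cball z R) (\<lambda>(t,x). u t x - v t x)"
      using contq[of "{T..T'} \<times> cball z R"] unfolding v_def A_def split_beta
      by (intro continuous_intros)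
    show "0 \<le> u T y - v T y" for y
    proof (cases "q T y > 0")
      case True
      then have "y \<in> ball z \<rho>" by (simp add: q_pos \<xi>_def dist_norm norm_minus_commute)
      from init[OF this] True show ?thesis by (simp add: v_def A_def q_def \<xi>_def)
    next
      case False
      then show ?thesis using nonneg[OF \<open>T > 0\<close>, of y] by (simp add: v_def)
    qed
    show "0 \<le> u t y - v t y" if t: "T \<le> t" "t \<le> T'" "dist z y = R" for t y
    proof -
      have "R \<le> norm (y - \<xi> t) + norm ((t - T) *\<^sub>R e)"
        using norm_triangle_ineq[of "y - \<xi> t" "(t - T) *\<^sub>R e"] t
        by (simp add: \<xi>_def dist_norm norm_minus_commute)
      also have "norm ((t - T) *\<^sub>R e) \<le> (T' - T) * norm e" using t by (simp add: mult_right_mono)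
      finally have "\<not> q t y > 0" unfolding q_pos R_def by simp
      then show ?thesis using nonneg[of t y] t pos by (simp add: v_def)
    qed
    show "\<exists>dt l. ((\<lambda>s. u s y - v s y) has_real_derivative dt) (at t) \<and>
        has_laplacian (\<lambda>x. u t x - v t x) y l \<and> dt - l > K * (u t y - v t y)"
      if t: "T < t" "t \<le> T'" and neg: "u t y - v t y < 0" for t y
    proof -
      have t0: "t > 0" using t pos by simp
      have qp: "q t y > 0"
        using neg nonneg[OF t0, of y] by (cases "q t y > 0") (auto simp: v_def)
      then have near: "norm (y - \<xi> t) < \<rho>" by (simp add: q_pos)
      define q' where "q' = 2 * ((y - \<xi> t) \<bullet> e) / \<rho>\<^sup>2"
      define vt where "vt = k * (q t y)\<^sup>2 + A t * (2 * q t y * q')"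
      define Lv where "Lv = A t / \<rho>\<^sup>2 * (8 - (4 * real DIM('a) + 8) * q t y)"
      have qd: "((\<lambda>s. q s y) has_real_derivative q') (at t)"
      proof -
        have "q s y = 1 - ((norm (y - z))\<^sup>2 - 2 * (s - T) * ((y - z) \<bullet> e) + (s - T)\<^sup>2 * (norm e)\<^sup>2) / \<rho>\<^sup>2" for s
          using norm_moving_square[of "y - z" "s - T" e] by (simp add: q_def \<xi>_def algebra_simps)
        \<comment> \<open>Expanding the square makes \<open>q\<close> a quadratic polynomial in
          time, so no derivative of the norm is involved.\<close>
        moreover have "((\<lambda>s. 1 - ((norm (y - z))\<^sup>2 - 2 * (s - T) * ((y - z) \<bullet> e) + (s - T)\<^sup>2 * (norm e)\<^sup>2) / \<rho>\<^sup>2)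
            has_real_derivative q') (at t)"
          unfolding divide_inverse q'_def
          by (rule derivative_eq_intros refl)+
             (simp add: \<xi>_def power2_norm_eq_inner inner_diff_left inner_add_left algebra_simps)
        ultimately show ?thesis by simp
      qed
      have vd: "((\<lambda>s. A s * (q s y)\<^sup>2) has_real_derivative vt) (at t)"
        unfolding A_def by (rule derivative_eq_intros qd refl)+ (simp add: vt_def A_def)
      have vev: "\<forall>\<^sub>F s in nhds t. A s * (q s y)\<^sup>2 = v s y"
      proof -
        have "isCont (\<lambda>s. q s y) t" using qd by (rule DERIV_isCont)
        then have "\<forall>\<^sub>F s in nhds t. q s y > 0"
          using qp order_tendstoD(1)[of "\<lambda>s. q s y" "q t y" "nhds t" 0]
          by (simp add: isCont_def tendsto_nhds_iff)
        then show ?thesis by eventually_elim (simp add: v_def)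
      qed
      have "((\<lambda>s. v s y) has_real_derivative vt) (at t)"
        using vd DERIV_cong_ev[OF refl vev refl] by simp
      then have d1: "((\<lambda>s. u s y - v s y) has_real_derivative (ut t y - vt)) (at t)"
        by (intro DERIV_diff C12D(5)[OF C t0])
      have "has_laplacian (\<lambda>w. - A t * (1 - (norm (w - \<xi> t))\<^sup>2 / \<rho>\<^sup>2)\<^sup>2) y (- Lv)"
        using has_laplacian_bump[OF pos(1), of "- A t" "\<xi> t" y] by (simp add: Lv_def q_def)
      moreover have "\<forall>\<^sub>F w in nhds y. - A t * (1 - (norm (w - \<xi> t))\<^sup>2 / \<rho>\<^sup>2)\<^sup>2 = - v t w"
      proof -
        have "\<forall>\<^sub>F w in nhds y. w \<in> ball (\<xi> t) \<rho>"
          using near by (intro eventually_nhds_in_open) (auto simp: dist_norm norm_minus_commute)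
        then show ?thesis
        proof eventually_elim
          case (elim w)
          then have "q t w > 0" by (simp add: q_pos dist_norm norm_minus_commute)
          then show ?case by (simp add: v_def q_def)
        qed
      qed
      ultimately have "has_laplacian (\<lambda>w. - v t w) y (- Lv)" by (rule has_laplacian_cong)
      from has_laplacian_add[OF C12_has_laplacian[OF C t0] this]
      have d2: "has_laplacian (\<lambda>w. u t w - v t w) y ((\<Sum>b\<in>Basis. ubb b t y) - Lv)" by simp
      note At = A_bd[of t]
      have v_eq: "v t y = A t * (q t y)\<^sup>2" using qp by (simp add: v_def)
      have q2: "(q t y)\<^sup>2 \<le> 1" using qp q_le[of t y] by (simp add: power_le_one)
      have "\<bar>(y - \<xi> t) \<bullet> e\<bar> \<le> \<rho> * norm e"
        using Cauchy_Schwarz_ineq2[of "y - \<xi> t" e] near mult_right_mono[of "norm (y - \<xi> t)" \<rho> "norm e"]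
        by simp
      then have "q' \<le> 2 * (\<rho> * norm e) / \<rho>\<^sup>2" unfolding q'_def using pos by (simp add: divide_right_mono)
      also have "\<dots> = 2 * norm e / \<rho>" using pos by (simp add: power2_eq_square)
      finally have q': "q' \<le> 2 * norm e / \<rho>" .
      \<comment> \<open>The transport part of \<open>vt\<close>; the other part, from the growing
        amplitude, is at most \<open>k\<close>.\<close>
      have "A t * (2 * q t y * q') \<le> a1 * (2 * 1 * (2 * norm e / \<rho>))"
      proof -
        have "2 * q t y * q' \<le> 2 * q t y * (2 * norm e / \<rho>)"
          using q' qp by (intro mult_left_mono) auto
        also have "\<dots> \<le> 2 * 1 * (2 * norm e / \<rho>)"
          using q_le[of t y] pos by (intro mult_right_mono mult_left_mono) auto
        finally have "A t * (2 * q t y * q') \<le> A t * (2 * 1 * (2 * norm e / \<rho>))"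
          using At t a by (intro mult_left_mono) auto
        also have "\<dots> \<le> a1 * (2 * 1 * (2 * norm e / \<rho>))"
          using At t pos by (intro mult_right_mono) auto
        finally show ?thesis .
      qed
      moreover have "k * (q t y)\<^sup>2 \<le> k" using q2 a by (simp add: mult_left_le)
      moreover have "a1 * (2 * 1 * (2 * norm e / \<rho>)) = 4 * a1 * norm e / \<rho>" by simp
      ultimately have "vt < \<kappa>" using a(5) unfolding vt_def by linarith
      also have "\<kappa> \<le> Lv + f (v t y)"
        unfolding Lv_def v_eq using At t qp q_le by (intro strict) auto
      finally have sub: "vt < Lv + f (v t y)" .
      have "v t y \<le> 1"
        unfolding v_eq using At t a q2 mult_left_le[of "(q t y)\<^sup>2" "A t"] by linarith
      \<comment> \<open>Here \<open>0 \<le> u t y < v t y \<le> 1\<close>, so the Lipschitz bound on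
        the unit interval applies, and the negative sign of the difference gives exactly the form
        required by the minimum principle.\<close>
      then have "\<bar>f (u t y) - f (v t y)\<bar> \<le> K * \<bar>u t y - v t y\<bar>"
        using neg nonneg[OF t0, of y] by (intro lip) auto
      also have "\<dots> = - (K * (u t y - v t y))" using neg by (simp add: abs_if algebra_simps)
      finally have "(ut t y - vt) - ((\<Sum>b\<in>Basis. ubb b t y) - Lv) > K * (u t y - v t y)"
        using sub eq[OF t0, of y] by linarith
      with d1 d2 show ?thesis by blast
    qed
  qed (use pos in auto)
  moreover have "q T' x > 0" using x by (simp add: q_pos \<xi>_def dist_norm norm_minus_commute)
  ultimately show ?thesis by (simp add: v_def A_def q_def \<xi>_def)
qed

subsection \<open>Consequences of Assumption (M)\<close>

text \<open>The dummy time set \<open>{0}\<close> brings the autonomous \<open>f\<close> into the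
  form for which local Lipschitz continuity yields one constant on a compact set.\<close>

lemma assumption_M_local_lipschitz:
  assumes "assumption_M f p"
  shows "local_lipschitz {0::real} (UNIV::real set) (\<lambda>_. f)"
proof (rule local_lipschitzI)
  fix t x :: real
  obtain d C where d: "d > 0" "C-lipschitz_on (ball x d) f"
    using assms unfolding assumption_M_def by blast
  have "C-lipschitz_on (cball x (d / 2)) f"
    using d by (intro lipschitz_on_subset[OF d(2)]) auto
  then show "\<exists>u>0. \<exists>L. \<forall>t\<in>cball t u \<inter> {0}. L-lipschitz_on (cball x u \<inter> UNIV) f"
    using d(1) by (intro exI[of _ "d / 2"]) auto
qed

lemma assumption_M_continuous_on:
  assumes "assumption_M f p"
  shows "continuous_on S f"
  using local_lipschitz_continuous_on[OF assumption_M_local_lipschitz[OF assms], of 0]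
  by (auto intro: continuous_on_subset)

lemma assumption_M_lipschitz:
  assumes "assumption_M f p"
  obtains K where "\<And>v w. 0 \<le> v \<Longrightarrow> v \<le> 1 \<Longrightarrow> 0 \<le> w \<Longrightarrow> w \<le> 1 \<Longrightarrow> \<bar>f v - f w\<bar> \<le> K * \<bar>v - w\<bar>"
proof -
  have "local_lipschitz {0::real} {0..1::real} (\<lambda>_. f)"
    using assumption_M_local_lipschitz[OF assms] by (rule local_lipschitz_subset) auto
  then obtain K where "K-lipschitz_on {0..1} f"
    by (rule local_lipschitz_compact_implies_lipschitz) auto
  then show ?thesis
    by (intro that[of K]) (auto simp: lipschitz_on_def dist_real_def)
qed

lemma assumption_M_nonneg:
  assumes "assumption_M f p"
  shows "f u \<ge> 0"
  using assms unfolding assumption_M_def by (cases "u \<le> 0"; cases "u \<ge> 1") (auto intro: less_imp_le)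

lemma assumption_M_bounded:
  assumes "assumption_M f p"
  obtains F where "F \<ge> 0" "\<And>u. f u \<le> F"
proof -
  have "compact (f ` {0..1})"
    by (intro compact_continuous_image assumption_M_continuous_on[OF assms]) auto
  then obtain F where F: "\<And>u. u \<in> {0..1} \<Longrightarrow> \<bar>f u\<bar> \<le> F"
    using compact_imp_bounded bounded_real by (metis (no_types, lifting) imageI)
  have "F \<ge> 0" using F[of 0] by simp
  moreover have "f u \<le> F" for u
  proof (cases "u \<in> {0..1}")
    case True
    then show ?thesis using F[of u] by simp
  next
    case False
    then have "f u = 0" using assms unfolding assumption_M_def by (cases "u \<le> 0") auto
    then show ?thesis using \<open>F \<ge> 0\<close> by simp
  qed
  ultimately show ?thesis by (rule that)
qed

text \<open>Near 0 the positive lower limit gives the constant. On the remaining compact interval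
  \<open>f\<close> has a positive minimum because \<open>a < 1\<close>, and there
  \<open>u powr p \<le> 1\<close>.\<close>

lemma assumption_M_power_lower_bound:
  assumes M: "assumption_M f p" and "a < 1"
  obtains c where "c > 0" "\<And>u. 0 < u \<Longrightarrow> u \<le> a \<Longrightarrow> c * u powr p \<le> f u"
proof -
  have p: "p > 1" and fpos: "\<And>u. 0 < u \<Longrightarrow> u < 1 \<Longrightarrow> f u > 0"
    and lim: "0 < Liminf (at_right 0) (\<lambda>u. ereal (f u / u powr p))"
    using M unfolding assumption_M_def by auto
  obtain l where l: "0 < l" "ereal l < Liminf (at_right 0) (\<lambda>u. ereal (f u / u powr p))"
    using ereal_dense2[OF lim] by auto
  have "\<forall>\<^sub>F u in at_right 0. ereal l < ereal (f u / u powr p)"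
    using less_LiminfD[OF l(2)] .
  then obtain \<delta> where \<delta>: "\<delta> > 0" "\<And>u. 0 < u \<Longrightarrow> u < \<delta> \<Longrightarrow> l < f u / u powr p"
    by (auto simp: eventually_at_right_field)
  have small: "l * u powr p \<le> f u" if "0 < u" "u < \<delta>" for u
    using \<delta>(2)[OF that] that by (simp add: pos_less_divide_eq)
  show ?thesis
  proof (cases "\<delta> \<le> a")
    case False
    then show ?thesis using l small by (intro that[of l]) auto
  next
    case True
    have "\<exists>v\<in>{\<delta>..a}. \<forall>u\<in>{\<delta>..a}. f v \<le> f u"
      using True by (intro continuous_attains_inf assumption_M_continuous_on[OF M]) auto
    then obtain v where v: "v \<in> {\<delta>..a}" "\<And>u. u \<in> {\<delta>..a} \<Longrightarrow> f v \<le> f u" by blast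
    have fv: "f v > 0" using v \<delta> \<open>a < 1\<close> by (intro fpos) auto
    show ?thesis
    proof (rule that[of "min l (f v)"])
      show "min l (f v) > 0" using l fv by simp
      fix u assume u: "0 < u" "u \<le> a"
      show "min l (f v) * u powr p \<le> f u"
      proof (cases "u < \<delta>")
        case True
        have "min l (f v) * u powr p \<le> l * u powr p" by (intro mult_right_mono) auto
        then show ?thesis using small[OF u(1) True] by linarith
      next
        case False
        have "u powr p \<le> 1" using u p \<open>a < 1\<close> powr_mono2[of p u 1] by simp
        then have "min l (f v) * u powr p \<le> f v * 1" using fv l by (intro mult_mono) auto
        then show ?thesis using v(2)[of u] u False by simp
      qed
    qed
  qed
qed

section \<open>Regularity and integrability of solutions\<close>

text \<open>The equation itself supplies the time derivative as the right-hand side, whose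
  continuity follows from that of \<open>f\<close> and of the second space derivatives.\<close>

lemma heat_solution_C12:
  assumes h: "heat_solution f u0 u" and f: "continuous_on UNIV f"
  shows "C12 u (\<lambda>t x. laplacian (u t) x + f (u t x)) (\<lambda>b t x. partial b (u t) x)
     (\<lambda>b t x. partial b (partial b (u t)) x)"
proof -
  have c: "continuous_on ({0<..} \<times> UNIV) (\<lambda>(t,x). u t x)"
    and c2: "\<And>b. b \<in> Basis \<Longrightarrow> continuous_on ({0<..} \<times> UNIV) (\<lambda>(t,x). partial b (partial b (u t)) x)"
    and c1: "\<And>b. b \<in> Basis \<Longrightarrow> continuous_on ({0<..} \<times> UNIV) (\<lambda>(t,x). partial b (u t) x)"
    and d1: "\<And>t x b. t > 0 \<Longrightarrow> b \<in> Basis \<Longrightarrow> (\<lambda>h. u t (x + h *\<^sub>R b)) differentiable (at 0)"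
    and d2: "\<And>t x b. t > 0 \<Longrightarrow> b \<in> Basis \<Longrightarrow> (\<lambda>h. partial b (u t) (x + h *\<^sub>R b)) differentiable (at 0)"
    and d3: "\<And>t x. t > 0 \<Longrightarrow> ((\<lambda>s. u s x) has_real_derivative (laplacian (u t) x + f (u t x))) (at t)"
    using h unfolding heat_solution_def by blast+
  have "continuous_on ({0<..} \<times> UNIV) (\<lambda>p. laplacian (u (fst p)) (snd p) + f (u (fst p) (snd p)))"
    unfolding laplacian_def
    using c c2 unfolding split_beta
    by (intro continuous_intros continuous_on_compose2[OF f]) auto
  moreover have "((\<lambda>h. u t (x + h *\<^sub>R b)) has_real_derivative partial b (u t) x) (at 0)"
    if "t > 0" "b \<in> Basis" for t x b
    using d1[OF that] unfolding partial_def by (simp add: DERIV_deriv_iff_real_differentiable)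
  moreover have "((\<lambda>h. partial b (u t) (x + h *\<^sub>R b)) has_real_derivative partial b (partial b (u t)) x) (at 0)"
    if "t > 0" "b \<in> Basis" for t x b
    using d2[OF that] unfolding partial_def[of b "partial b (u t)"]
    by (simp add: DERIV_deriv_iff_real_differentiable)
  ultimately show ?thesis
    using c c1 c2 d3 unfolding C12_def split_beta by simp
qed

text \<open>Monotonicity of \<open>integral\<close> presupposes integrability, whereas the notion of
  solution only states a limit of integrals.\<close>

lemma integrable_on_cbox_diff_indicator:
  fixes g :: "'a::euclidean_space \<Rightarrow> real"
  assumes "continuous_on UNIV g"
  shows "(\<lambda>x. \<bar>g x - c * indicator (ball z L) x\<bar>) integrable_on cbox a b"
proof -
  have "g absolutely_integrable_on cbox a b"
    using assms by (intro absolutely_integrable_continuous) (auto intro: continuous_on_subset)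
  moreover have "(\<lambda>x. c * indicator (ball z L) x) absolutely_integrable_on cbox a b"
  proof (rule set_integrable_mult_right)
    show "(indicator (ball z L) :: 'a \<Rightarrow> real) absolutely_integrable_on cbox a b"
      using emeasure_bounded_finite[of "cbox a b \<inter> ball z L"] unfolding set_integrable_def
      by (simp add: indicator_inter_arith[symmetric] integrable_indicator_iff bounded_Int)
  qed
  ultimately have "(\<lambda>x. g x - c * indicator (ball z L) x) absolutely_integrable_on cbox a b"
    by (rule set_integral_diff)
  then show ?thesis
    unfolding absolutely_integrable_on_def by simp
qed

subsection \<open>Convergence to 1\<close>

text \<open>Nonnegativity comes from ever flatter paraboloids, the plateau from one fitting under
  the datum. For the upper bound, the same comparison for \<open>- u\<close> gives
  \<open>u \<le> eps + F * t\<close>, hence \<open>u \<le> 1\<close> for a short time because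
  \<open>eps < 1\<close>; from then on the minimum principle applies directly, as \<open>f\<close>
  vanishes above 1.\<close>

lemma heat_solution_ball_datum_bounds:
  fixes u :: "real \<Rightarrow> 'a::euclidean_space \<Rightarrow> real"
  assumes M: "assumption_M f p" and h: "heat_solution f (\<lambda>x. eps * indicator (ball 0 L) x) u"
    and eps: "0 < eps" "eps < 1" and L: "L > 0"
  shows heat_solution_nonneg: "t > 0 \<Longrightarrow> 0 \<le> u t x"
    and heat_solution_le_1: "t > 0 \<Longrightarrow> u t x \<le> 1"
    and heat_solution_initial_plateau: "\<lbrakk>0 < t; t \<le> L\<^sup>2 / (8 * (2 * real DIM('a) + 1)); norm x \<le> L / 2\<rbrakk> \<Longrightarrow> eps / 2 \<le> u t x"
proof -
  let ?u0 = "\<lambda>x::'a. eps * indicator (ball 0 L) x :: real"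
  from h have "\<exists>B. \<forall>t>0. \<forall>x. \<bar>u t x\<bar> \<le> B"
    unfolding heat_solution_def by (rule conjunct1)
  then obtain B where B: "\<And>t x. t > 0 \<Longrightarrow> \<bar>u t x\<bar> \<le> B" by blast
  have tr: "((\<lambda>t. integral (cbox a c) (\<lambda>x. \<bar>u t x - ?u0 x\<bar>)) \<longlongrightarrow> 0) (at_right 0)" for a c
    using h unfolding heat_solution_def by (elim conjE) (simp add: compact_cbox)
  note C = heat_solution_C12[OF h assumption_M_continuous_on[OF M]]
  have int: "(\<lambda>x. \<bar>u t x - ?u0 x\<bar>) integrable_on cbox a c" if "t > 0" for t a c
    by (intro integrable_on_cbox_diff_indicator continuous_on_slice[OF C12D(1)[OF C] that])
  have eq: "laplacian (u t) x + f (u t x) - (\<Sum>b\<in>Basis. partial b (partial b (u t)) x) = f (u t x)" for t x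
    by (simp add: laplacian_def)
  note f0 = assumption_M_nonneg[OF M]
  have lower: "A - b * (2 * real DIM('a) + 1) * t \<le> u t z"
    if "t > 0" "b > 0" "\<And>x. A - b * (norm (x - z))\<^sup>2 \<le> ?u0 x" for A b t z
    using lower_bound_from_L1_trace[OF C, of B 0 ?u0 A b z t] B f0 tr int that
    by (simp add: eq abs_le_iff minus_le_iff)
  show nonneg: "0 \<le> u t x" if t: "t > 0" for t x
  proof (rule field_le_epsilon)
    fix e :: real assume e: "e > 0"
    \<comment> \<open>The paraboloid sinks by exactly \<open>e\<close> up to time
      \<open>t\<close>.\<close>
    define b where "b = e / ((2 * real DIM('a) + 1) * t)"
    have "b > 0" using e t by (simp add: b_def)
    have "0 - b * (norm (y - x))\<^sup>2 \<le> ?u0 y" for y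
    proof -
      have "0 \<le> b * (norm (y - x))\<^sup>2" using \<open>b > 0\<close> by simp
      moreover have "0 \<le> ?u0 y" using eps by simp
      ultimately show ?thesis by linarith
    qed
    from lower[OF t \<open>b > 0\<close> this] have "- (b * (2 * real DIM('a) + 1) * t) \<le> u t x" by simp
    moreover have "b * (2 * real DIM('a) + 1) * t = e" using t by (simp add: b_def)
    ultimately show "0 \<le> u t x + e" by linarith
  qed
  show "eps / 2 \<le> u t x" if t: "0 < t" "t \<le> L\<^sup>2 / (8 * (2 * real DIM('a) + 1))" "norm x \<le> L / 2" for t x
  proof -
    \<comment> \<open>The paraboloid has height \<open>eps\<close> and reaches 0 at distance
      \<open>L / 2\<close> from \<open>x\<close>, hence still within the ball of radius
      \<open>L\<close>. The time bound lets it sink by at most \<open>eps / 2\<close>.\<close>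
    define b where "b = eps / (L / 2)\<^sup>2"
    have "b > 0" using eps L by (simp add: b_def)
    have "eps - b * (norm (y - x))\<^sup>2 \<le> ?u0 y" for y
    proof (cases "y \<in> ball 0 L")
      case True
      then show ?thesis using \<open>b > 0\<close> by simp
    next
      case False
      then have "L / 2 \<le> norm (y - x)" using t norm_triangle_ineq2[of y x] by simp
      then have "(L / 2)\<^sup>2 \<le> (norm (y - x))\<^sup>2" using L by (intro power_mono) auto
      then have "b * (L / 2)\<^sup>2 \<le> b * (norm (y - x))\<^sup>2" using \<open>b > 0\<close> by (intro mult_left_mono) auto
      moreover have "b * (L / 2)\<^sup>2 = eps" using L by (simp add: b_def)
      ultimately show ?thesis using False by simp
    qed
    from lower[OF t(1) \<open>b > 0\<close> this] have "eps - b * (2 * real DIM('a) + 1) * t \<le> u t x" .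
    moreover have "b * (2 * real DIM('a) + 1) * t \<le> b * (2 * real DIM('a) + 1) * (L\<^sup>2 / (8 * (2 * real DIM('a) + 1)))"
      using t \<open>b > 0\<close> by (intro mult_left_mono) auto
    moreover have "b * (2 * real DIM('a) + 1) * (L\<^sup>2 / (8 * (2 * real DIM('a) + 1))) = b * L\<^sup>2 / 8"
      by (simp add: divide_simps)
    moreover have "b * L\<^sup>2 / 8 = eps / 2" using L by (simp add: b_def power_divide)
    ultimately show ?thesis by linarith
  qed
  obtain F where F: "F \<ge> 0" "\<And>u. f u \<le> F" using assumption_M_bounded[OF M] by blast
  have upper: "u t x \<le> eps + F * t" if t: "t > 0" for t x
  proof (rule field_le_epsilon)
    fix e :: real assume e: "e > 0"
    define b where "b = e / ((2 * real DIM('a) + 1) * t)"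
    have "b > 0" using e t by (simp add: b_def)
    have w0: "- eps - b * (norm (y - x))\<^sup>2 \<le> - ?u0 y" for y
    proof -
      have "0 \<le> b * (norm (y - x))\<^sup>2" using \<open>b > 0\<close> by simp
      moreover have "?u0 y \<le> eps" using eps by (simp add: indicator_def)
      ultimately show ?thesis by linarith
    qed
    have sw: "\<bar>- u t x - - ?u0 x\<bar> = \<bar>u t x - ?u0 x\<bar>" for t x by simp
    have "- eps - (b * (2 * real DIM('a) + 1) + F) * t \<le> - u t x"
    proof (rule lower_bound_from_L1_trace[OF C12_uminus[OF C], of B F "\<lambda>x. - ?u0 x"])
      show "- F \<le> - (laplacian (u s) y + f (u s y)) - (\<Sum>b\<in>Basis. - partial b (partial b (u s)) y)" for s y
        using F(2)[of "u s y"] by (simp add: laplacian_def sum_negf)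
      show "((\<lambda>s. integral (cbox a c) (\<lambda>y. \<bar>- u s y - - ?u0 y\<bar>)) \<longlongrightarrow> 0) (at_right 0)" for a c
        unfolding sw by (rule tr)
      show "(\<lambda>y. \<bar>- u s y - - ?u0 y\<bar>) integrable_on cbox a c" if "s > 0" for s a c
        unfolding sw by (rule int[OF that])
      show "- B \<le> - u s y" if "s > 0" for s y
        using B[OF that, of y] by linarith
    qed (use F w0 \<open>b > 0\<close> t in auto)
    moreover have "b * (2 * real DIM('a) + 1) * t = e" using t by (simp add: b_def)
    then have "(b * (2 * real DIM('a) + 1) + F) * t = e + F * t" by (simp only: distrib_right)
    ultimately show "u t x \<le> eps + F * t + e" by linarith
  qed
  \<comment> \<open>Ensures \<open>eps + F * t1 \<le> 1\<close>; the summand 1 guards against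
    \<open>F = 0\<close>.\<close>
  define t1 where "t1 = (1 - eps) / (F + 1)"
  have t1: "t1 > 0" using eps F by (simp add: t1_def)
  have early: "u t x \<le> 1" if "t > 0" "t \<le> t1" for t x
  proof -
    have "F * t \<le> (F + 1) * t1" using that F by (intro mult_mono) auto
    also have "\<dots> = 1 - eps" using F by (simp add: t1_def)
    finally show ?thesis using upper[OF that(1), of x] by linarith
  qed
  show "u t x \<le> 1" if t: "t > 0" for t x
  proof (cases "t \<le> t1")
    case True
    then show ?thesis using early t by blast
  next
    case False
    show ?thesis
    proof (rule field_le_epsilon)
      fix e :: real assume e: "e > 0"
      \<comment> \<open>Normalised so that the barrier in \<open>d\<close> has value
        \<open>1 + e\<close> at the point \<open>x\<close> and time \<open>t\<close>.\<close>
      define \<delta> where "\<delta> = e / (1 + (2 * real DIM('a) + 1) * t)"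
      have \<delta>: "\<delta> > 0" using e t by (simp add: \<delta>_def add_pos_nonneg)
      define R where "R = 1 + \<bar>B\<bar> / \<delta>"
      define d where "d = (\<lambda>s y. - u s y + (1 + \<delta> + \<delta> * (norm (y - x))\<^sup>2 + \<delta> * (2 * real DIM('a) + 1) * s))"
      note Cd = C12_add[OF C12_uminus[OF C] C12_quadratic[of "1 + \<delta>" \<delta> x "\<delta> * (2 * real DIM('a) + 1)"],
          folded d_def]
      have extra: "0 \<le> \<delta> * (norm (y - x))\<^sup>2" "0 \<le> \<delta> * (2 * real DIM('a) + 1) * s" if "s \<ge> 0" for s y
        using \<delta> that by simp_all
      have "0 \<le> d t x"
      proof (rule parabolic_minimum_principle[of t1 t x R d 0])
        show "continuous_on ({t1..t} \<times> cball x R) (\<lambda>(t,x). d t x)"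
          using t1 by (intro continuous_on_subset[OF C12D(1)[OF Cd]]) auto
        show "0 \<le> d t1 y" for y
          using early[OF t1, of y] extra(1)[of t1 y] extra(2)[of t1] t1 \<delta> unfolding d_def by linarith
        show "0 \<le> d s y" if s: "t1 \<le> s" "dist x y = R" for s y
        proof -
          have "norm (y - x) \<ge> 1" using s \<delta> by (simp add: dist_norm norm_minus_commute R_def)
          then have "norm (y - x) * 1 \<le> norm (y - x) * norm (y - x)" by (intro mult_left_mono) auto
          then have "R \<le> (norm (y - x))\<^sup>2"
            using s by (simp add: dist_norm norm_minus_commute power2_eq_square)
          then have "\<delta> * R \<le> \<delta> * (norm (y - x))\<^sup>2" using \<delta> by (intro mult_left_mono) auto
          moreover have "\<delta> * R = \<delta> + \<bar>B\<bar>" using \<delta> by (simp add: R_def distrib_left)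
          ultimately show ?thesis
            using B[of s y] extra(2)[of s] s t1 \<delta> unfolding d_def by linarith
        qed
        show "\<exists>dt l. ((\<lambda>s. d s y) has_real_derivative dt) (at s) \<and> has_laplacian (d s) y l \<and> dt - l > 0 * d s y"
          if s: "t1 < s" "d s y < 0" for s y
        proof (intro exI conjI)
          have s0: "s > 0" using s t1 by simp
          show "((\<lambda>s. d s y) has_real_derivative - (laplacian (u s) y + f (u s y)) + \<delta> * (2 * real DIM('a) + 1)) (at s)"
            by (rule C12D(5)[OF Cd s0])
          show "has_laplacian (d s) y (\<Sum>b\<in>Basis. - partial b (partial b (u s)) y + 2 * \<delta>)"
            by (rule C12_has_laplacian[OF Cd s0])
          \<comment> \<open>The barrier is above 1, so a negative \<open>d\<close> forces
            \<open>u > 1\<close> and the reaction is off; what remains of the heat operator on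
            \<open>d\<close> is \<open>\<delta>\<close>.\<close>
          have "u s y > 1" using s(2) extra(1)[of s y] extra(2)[of s] s0 \<delta> unfolding d_def by linarith
          then have "f (u s y) = 0" using M unfolding assumption_M_def by simp
          then show "- (laplacian (u s) y + f (u s y)) + \<delta> * (2 * real DIM('a) + 1)
              - (\<Sum>b\<in>Basis. - partial b (partial b (u s)) y + 2 * \<delta>) > 0 * d s y"
            using \<delta> unfolding laplacian_def sum.distrib sum_negf by (simp add: algebra_simps)
        qed
      qed (use False \<delta> in \<open>auto simp: R_def\<close>)
      then have "u t x \<le> 1 + \<delta> * (1 + (2 * real DIM('a) + 1) * t)" by (simp add: d_def algebra_simps)
      also have "\<delta> * (1 + (2 * real DIM('a) + 1) * t) = e"
        using t unfolding \<delta>_def by (smt (verit) nonzero_eq_divide_eq mult_nonneg_nonneg of_nat_0_le_iff)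
      finally show "u t x \<le> 1 + e" .
    qed
  qed
qed

text \<open>The bump comparison is used three times: growth with a fixed centre, transport with a
  fixed amplitude, then growth again with a larger radius. The hypothesis \<open>big\<close> is the
  subsolution condition for amplitude \<open>eps / 2\<close> and radius \<open>L / 2\<close>, the
  data of the initial plateau.\<close>

lemma heat_solution_converges_to_1:
  fixes u :: "real \<Rightarrow> 'a::euclidean_space \<Rightarrow> real"
  assumes M: "assumption_M f p" and h: "heat_solution f (\<lambda>x. eps * indicator (ball 0 L) x) u"
    and eps: "0 < eps" "eps < 1" and L: "L > 0"
    and c: "c > 0" "\<And>u. 0 < u \<Longrightarrow> u \<le> 1 / 2 \<Longrightarrow> c * u powr p \<le> f u"
    and big: "c * (eps / 2) powr (p - 1) * (1 / (real DIM('a) + 2)\<^sup>2) powr p > 4 * real DIM('a) / (L / 2)\<^sup>2"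
    and K: "compact K"
  shows "uniform_limit K u (\<lambda>x. 1) at_top"
proof -
  have p: "p > 1" using M by (simp add: assumption_M_def)
  define \<rho> where "\<rho> = L / 2"
  have \<rho>: "\<rho> > 0" using L by (simp add: \<rho>_def)
  note C = heat_solution_C12[OF h assumption_M_continuous_on[OF M]]
  have eq: "laplacian (u t) x + f (u t x) - (\<Sum>b\<in>Basis. partial b (partial b (u t)) x) = f (u t x)" for t x
    by (simp add: laplacian_def)
  note nonneg = heat_solution_nonneg[OF M h eps L]
  obtain \<Lambda> where lip: "\<And>v w. 0 \<le> v \<Longrightarrow> v \<le> 1 \<Longrightarrow> 0 \<le> w \<Longrightarrow> w \<le> 1 \<Longrightarrow> \<bar>f v - f w\<bar> \<le> \<Lambda> * \<bar>v - w\<bar>"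
    using assumption_M_lipschitz[OF M] by blast
  note compare = moving_bump_comparison[OF C eq nonneg lip]
  have scale: "m * (1 - (norm (x - z))\<^sup>2 / r\<^sup>2)\<^sup>2 \<le> m" if "x \<in> ball z r" "r > 0" "m \<ge> 0" for x z :: 'a and m r
  proof -
    have "(norm (x - z))\<^sup>2 \<le> r\<^sup>2"
      using that by (intro power_mono) (auto simp: dist_norm norm_minus_commute)
    then have "\<bar>1 - (norm (x - z))\<^sup>2 / r\<^sup>2\<bar> \<le> 1" using that by (simp add: abs_le_iff)
    then have "(1 - (norm (x - z))\<^sup>2 / r\<^sup>2)\<^sup>2 \<le> 1" by (simp add: abs_square_le_1)
    then show ?thesis using that by (simp add: mult_left_le)
  qed
  obtain \<kappa> where \<kappa>: "\<kappa> > 0" "\<And>a q. eps / 2 \<le> a \<Longrightarrow> a \<le> 1 / 2 \<Longrightarrow> 0 < q \<Longrightarrow> q \<le> 1 \<Longrightarrow>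
     \<kappa> \<le> a / \<rho>\<^sup>2 * (8 - (4 * real DIM('a) + 8) * q) + f (a * q\<^sup>2)"
    using bump_strict_subsolution[OF p c assumption_M_nonneg[OF M] half_gt_zero[OF eps(1)] \<rho>
        of_nat_0_le_iff big[folded \<rho>_def]] by blast
  define t0 where "t0 = L\<^sup>2 / (8 * (2 * real DIM('a) + 1))"
  have t0: "t0 > 0" unfolding t0_def using L by (intro divide_pos_pos) auto
  \<comment> \<open>Growth from \<open>eps / 2\<close> to \<open>1 / 2\<close> at rate
    \<open>\<kappa> / 2\<close>, half of the margin.\<close>
  define T where "T = t0 + (1 - eps) / \<kappa>"
  have T: "T \<ge> t0" "T > 0" using t0 eps \<kappa> by (simp_all add: T_def add_pos_nonneg)
  have grown: "1 / 2 * (1 - (norm (x - 0))\<^sup>2 / \<rho>\<^sup>2)\<^sup>2 \<le> u T x" if x: "x \<in> ball 0 \<rho>" for x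
  proof -
    have k: "eps / 2 + \<kappa> / 2 * (T - t0) = 1 / 2" using \<kappa> by (simp add: T_def field_simps)
    have "(eps / 2 + \<kappa> / 2 * (T - t0)) * (1 - (norm (x - (0 + (T - t0) *\<^sub>R 0)))\<^sup>2 / \<rho>\<^sup>2)\<^sup>2 \<le> u T x"
    proof (rule compare[of "eps / 2" "1 / 2" \<kappa> \<rho>])
      fix y :: 'a assume y: "y \<in> ball 0 \<rho>"
      have "eps / 2 \<le> u t0 y"
        using y by (intro heat_solution_initial_plateau[OF M h eps L t0]) (auto simp: t0_def \<rho>_def)
      then show "eps / 2 * (1 - (norm (y - 0))\<^sup>2 / \<rho>\<^sup>2)\<^sup>2 \<le> u t0 y"
        using scale[OF y \<rho>, of "eps / 2"] eps by linarith
    qed (use eps \<kappa> t0 T \<rho> k x in auto)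
    then show ?thesis unfolding k by simp
  qed
  \<comment> \<open>At amplitude \<open>1 / 2\<close>, moving with speed below \<open>s\<close>
    costs less than \<open>\<kappa> / 2\<close>.\<close>
  define s where "s = \<rho> * \<kappa> / 4"
  have s: "s > 0" using \<rho> \<kappa> by (simp add: s_def)
  have spread: "1 / 2 \<le> u t x" if t: "t > T + norm x / s" for t x
  proof -
    have n: "0 \<le> norm x / s" using s by simp
    have tT: "t > T" using t n by linarith
    \<comment> \<open>The velocity that brings the centre to \<open>x\<close> exactly at time
      \<open>t\<close>, so the peak value \<open>1 / 2\<close> is attained there.\<close>
    define e where "e = x /\<^sub>R (t - T)"
    have e: "(t - T) *\<^sub>R e = x" using tT by (simp add: e_def)
    have "norm x < s * (t - T)" using t s by (simp add: field_simps)
    then have ne: "norm e < s" using tT by (simp add: e_def field_simps)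
    have "(1 / 2 + 0 * (t - T)) * (1 - (norm (x - (0 + (t - T) *\<^sub>R e)))\<^sup>2 / \<rho>\<^sup>2)\<^sup>2 \<le> u t x"
    proof (rule compare[of "1 / 2" "1 / 2" \<kappa> \<rho>])
      show "0 + 4 * (1 / 2) * norm e / \<rho> < \<kappa>"
      proof -
        have "4 * (1 / 2) * norm e / \<rho> < 4 * (1 / 2) * s / \<rho>"
          using ne \<rho> by (intro divide_strict_right_mono) auto
        also have "\<dots> = \<kappa> / 2" using \<rho> by (simp add: s_def)
        finally show ?thesis using \<kappa>(1) by simp
      qed
      show "1 / 2 * (1 - (norm (y - 0))\<^sup>2 / \<rho>\<^sup>2)\<^sup>2 \<le> u T y" if "y \<in> ball 0 \<rho>" for y
        by (rule grown[OF that])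
    qed (use eps \<kappa> T tT \<rho> e in auto)
    then show ?thesis by (simp add: e)
  qed
  obtain R where R: "R > 0" "\<And>x. x \<in> K \<Longrightarrow> norm x \<le> R"
    using compact_imp_bounded[OF K] bounded_pos by metis
  show ?thesis
  proof (rule uniform_limitI)
    fix \<eta>' :: real assume "\<eta>' > 0"
    define \<eta> where "\<eta> = min (\<eta>' / 2) (1 / 2)"
    have \<eta>: "0 < \<eta>" "\<eta> < \<eta>'" "\<eta> \<le> 1 / 2" using \<open>\<eta>' > 0\<close> by (auto simp: \<eta>_def min_def)
    obtain c' where c': "c' > 0" "\<And>u. 0 < u \<Longrightarrow> u \<le> 1 - \<eta> \<Longrightarrow> c' * u powr p \<le> f u"
      using assumption_M_power_lower_bound[OF M, of "1 - \<eta>"] \<eta> by auto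
    define g where "g = c' * (1 / 2) powr (p - 1) * (1 / (real DIM('a) + 2)\<^sup>2) powr p"
    have g: "g > 0" using c' by (simp add: g_def)
    \<comment> \<open>Makes \<open>4 * DIM('a) / r\<^sup>2\<close> equal to \<open>g / 2\<close>,
      hence strictly below \<open>g\<close>.\<close>
    define r where "r = sqrt (8 * real DIM('a) / g)"
    have r: "r > 0" "r\<^sup>2 = 8 * real DIM('a) / g" using g by (simp_all add: r_def)
    have big': "c' * (1 / 2) powr (p - 1) * (1 / (real DIM('a) + 2)\<^sup>2) powr p > 4 * real DIM('a) / r\<^sup>2"
      using g unfolding g_def[symmetric] by (simp add: r)
    obtain \<kappa>' where \<kappa>': "\<kappa>' > 0" "\<And>a q. 1 / 2 \<le> a \<Longrightarrow> a \<le> 1 - \<eta> \<Longrightarrow> 0 < q \<Longrightarrow> q \<le> 1 \<Longrightarrow>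
       \<kappa>' \<le> a / r\<^sup>2 * (8 - (4 * real DIM('a) + 8) * q) + f (a * q\<^sup>2)"
      using bump_strict_subsolution[OF p c' assumption_M_nonneg[OF M] _ r(1) of_nat_0_le_iff big',
          of "1 - \<eta>"] by auto
    \<comment> \<open>The time to grow from \<open>1 / 2\<close> to \<open>1 - \<eta>\<close>. It
      does not depend on the centre, which makes the convergence uniform on
      \<open>K\<close>.\<close>
    define \<tau> where "\<tau> = (1 / 2 - \<eta>) / (\<kappa>' / 2)"
    have \<tau>: "\<tau> \<ge> 0" "\<kappa>' / 2 * \<tau> = 1 / 2 - \<eta>" using \<eta> \<kappa>' by (simp_all add: \<tau>_def)
    have close: "dist (u t x) 1 < \<eta>'" if t: "t > T + (R + r) / s + \<tau>" and x: "x \<in> K" for t x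
    proof -
      have "0 \<le> (R + r) / s" using R r s by simp
      then have tt: "t - \<tau> > 0" "t > 0" using t T \<tau> by linarith+
      have lag: "t - (t - \<tau>) = \<tau>" by simp
      have "(1 / 2 + \<kappa>' / 2 * (t - (t - \<tau>))) * (1 - (norm (x - (x + (t - (t - \<tau>)) *\<^sub>R 0)))\<^sup>2 / r\<^sup>2)\<^sup>2 \<le> u t x"
      proof (rule compare[of "1 / 2" "1 - \<eta>" \<kappa>' r])
        show "1 / 2 + \<kappa>' / 2 * (t - (t - \<tau>)) \<le> 1 - \<eta>"
          unfolding lag \<tau>(2) by simp
        fix y :: 'a assume y: "y \<in> ball x r"
        have "norm y \<le> R + r"
          using norm_triangle_sub[of y x] y R(2)[OF x] by (simp add: dist_norm norm_minus_commute)
        then have "norm y / s \<le> (R + r) / s" using s by (simp add: divide_right_mono)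
        then have "1 / 2 \<le> u (t - \<tau>) y" using t by (intro spread) linarith
        then show "1 / 2 * (1 - (norm (y - x))\<^sup>2 / r\<^sup>2)\<^sup>2 \<le> u (t - \<tau>) y"
          using scale[OF y r(1), of "1 / 2"] by linarith
      qed (use \<eta> \<kappa>' \<tau>(1) r tt in auto)
      then have "1 - \<eta> \<le> u t x" unfolding lag \<tau>(2) by simp
      moreover have "u t x \<le> 1" by (rule heat_solution_le_1[OF M h eps L tt(2)])
      ultimately show ?thesis using \<eta> by (simp add: dist_real_def)
    qed
    show "\<forall>\<^sub>F t in at_top. \<forall>x\<in>K. dist (u t x) 1 < \<eta>'"
      using eventually_gt_at_top[of "T + (R + r) / s + \<tau>"]
      by eventually_elim (use close in blast)
  qed
qed

section \<open>Choice of the threshold radius\<close>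

theorem theorem6p3:
  fixes f :: "real \<Rightarrow> real" and p :: real
  assumes "assumption_M f p"
  shows "\<exists>Cplus::real. Cplus > 0 \<and> (\<exists>eps0::real. eps0 > 0 \<and>
     (\<exists>Leps :: real \<Rightarrow> real.
        (\<forall>eps. 0 < eps \<and> eps < eps0 \<longrightarrow> Leps eps > 0 \<and>
           (\<forall>L > Leps eps. \<forall>u :: real \<Rightarrow> 'a::euclidean_space \<Rightarrow> real.
              heat_solution f (\<lambda>x. eps * indicator (ball 0 L) x) u \<longrightarrow>
              (\<forall>K. compact K \<longrightarrow> uniform_limit K u (\<lambda>x. 1) at_top))) \<and>
        Leps \<sim>[at_right 0]
          (\<lambda>eps. Cplus * eps powr (-(p - 1) / 2) * (ln (1 / eps)) powr (1 / 2))))"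
proof -
  obtain c where c: "c > 0" "\<And>u. 0 < u \<Longrightarrow> u \<le> 1 / 2 \<Longrightarrow> c * u powr p \<le> f u"
    using assumption_M_power_lower_bound[OF assms, of "1 / 2"] by auto
  define G where "G = c * (1 / 2) powr (p - 1) * (1 / (real DIM('a) + 2)\<^sup>2) powr p"
  have G: "G > 0" using c by (simp add: G_def)
  \<comment> \<open>The subsolution condition for amplitude \<open>eps / 2\<close> and radius
    \<open>L / 2\<close> amounts to \<open>L\<^sup>2 * eps powr (p - 1) > \<Lambda>\<close>.\<close>
  define \<Lambda> where "\<Lambda> = 16 * real DIM('a) / G"
  \<comment> \<open>Taken equal to the comparison function with constant 1, so the asymptotic
    equivalence is reflexivity.\<close>
  define Leps :: "real \<Rightarrow> real" where
    "Leps = (\<lambda>eps. 1 * eps powr (-(p - 1) / 2) * (ln (1 / eps)) powr (1 / 2))"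
  have main: "Leps eps > 0 \<and> (\<forall>L > Leps eps. \<forall>u :: real \<Rightarrow> 'a \<Rightarrow> real.
      heat_solution f (\<lambda>x. eps * indicator (ball 0 L) x) u \<longrightarrow>
      (\<forall>K. compact K \<longrightarrow> uniform_limit K u (\<lambda>x. 1) at_top))"
    if eps: "0 < eps" "eps < exp (- \<Lambda>)" for eps
  proof (intro conjI allI impI)
    have "\<Lambda> > 0" using G by (simp add: \<Lambda>_def)
    have "exp (- \<Lambda>) < 1" using \<open>\<Lambda> > 0\<close> by simp
    then have eps1: "eps < 1" using eps by linarith
    have "ln eps < ln (exp (- \<Lambda>))" using eps by (subst ln_less_cancel_iff) auto
    \<comment> \<open>The bound \<open>exp (- \<Lambda>)\<close> on \<open>eps\<close> makes the
      logarithm, which enters \<open>(Leps eps)\<^sup>2\<close> to the first power, exceed the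
      required constant.\<close>
    then have ln: "ln (1 / eps) > \<Lambda>" using eps by (simp add: ln_div)
    then have ln0: "ln (1 / eps) > 0" using \<open>\<Lambda> > 0\<close> by linarith
    show Lp: "Leps eps > 0" unfolding Leps_def using eps ln0 by simp
    fix L :: real and u :: "real \<Rightarrow> 'a \<Rightarrow> real" and K :: "'a set"
    assume L: "Leps eps < L" and h: "heat_solution f (\<lambda>x. eps * indicator (ball 0 L) x) u" and K: "compact K"
    have L0: "L > 0" using L Lp by linarith
    have sq: "(Leps eps)\<^sup>2 = eps powr (- (p - 1)) * ln (1 / eps)"
    proof -
      have "(eps powr (-(p - 1) / 2))\<^sup>2 = eps powr (-(p - 1) / 2 + -(p - 1) / 2)"
        unfolding powr_add by (rule power2_eq_square)
      also have "-(p - 1) / 2 + -(p - 1) / 2 = - (p - 1)" by (simp add: field_simps)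
      finally show ?thesis
        unfolding Leps_def using ln0 by (simp add: power_mult_distrib powr_half_sqrt)
    qed
    have "eps powr (- (p - 1)) * \<Lambda> < L\<^sup>2"
    proof -
      have "eps powr (- (p - 1)) * \<Lambda> < (Leps eps)\<^sup>2"
        unfolding sq using ln eps by (intro mult_strict_left_mono) auto
      also have "\<dots> < L\<^sup>2" using L Lp by (intro power_strict_mono) auto
      finally show ?thesis .
    qed
    then have "eps powr (p - 1) * (eps powr (- (p - 1)) * \<Lambda>) < eps powr (p - 1) * L\<^sup>2"
      using eps by (intro mult_strict_left_mono) auto
    then have "\<Lambda> < eps powr (p - 1) * L\<^sup>2"
      using eps by (simp add: powr_add[symmetric] mult.assoc[symmetric])
    then have "16 * real DIM('a) / L\<^sup>2 < G * eps powr (p - 1)"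
      using G L0 by (simp add: \<Lambda>_def field_simps)
    moreover have "c * (eps / 2) powr (p - 1) * (1 / (real DIM('a) + 2)\<^sup>2) powr p = G * eps powr (p - 1)"
      using powr_mult[of eps "1 / 2" "p - 1"] by (simp add: G_def)
    moreover have "4 * real DIM('a) / (L / 2)\<^sup>2 = 16 * real DIM('a) / L\<^sup>2" by (simp add: power_divide)
    ultimately have "c * (eps / 2) powr (p - 1) * (1 / (real DIM('a) + 2)\<^sup>2) powr p > 4 * real DIM('a) / (L / 2)\<^sup>2"
      by linarith
    then show "uniform_limit K u (\<lambda>x. 1) at_top"
      by (intro heat_solution_converges_to_1[OF assms h eps(1) eps1 L0 c _ K])
  qed
  show ?thesis
    by (rule exI[of _ 1], intro conjI zero_less_one, rule exI[of _ "exp (- \<Lambda>)"],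
        intro conjI exp_gt_zero, rule exI[of _ Leps])
       (use main in \<open>auto simp: Leps_def\<close>)
qed

end
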